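(* Let $f$ be a probability density function on $\mathbb{T}$ and let $\{\ell_n\}_{n\in\mathbb{N}}$ be a decreasing sequence of positive numbers with $0<\ell_n<1$ satisfying $$\limsup_{n\to\infty}\left(\frac{\ell_1+\dots+\ell_n}{\ln n}\right)\ \ge\ \frac{1}{m_f},$$ with the convention $1/m_f=\infty$ when $m_f=0$ (the case $m_f=0$ is allowed). If $|K_f|=0$, then for every $\varepsilon>0$ there exists a probability density function $f_0$ on $\mathbb{T}$ such that $m_{f_0}=m_f$, $K_{f_0}=K_f$, $$|\{x\in\mathbb{T}: f(x)\ne f_0(x)\}|\le\varepsilon,$$ and the circle $\mathbb{T}$ is $\mu_{f_0}$-Dvoretzky covered for $\{\ell_n\}_{n\in\mathbb{N}}$.
   Context: $\mathbb{T}=\mathbb{R}/\mathbb{Z}$ is the circle with its usual metric and Lebesgue measure $|\cdot|$ (total mass $1$). A probability density function is a nonnegative $g\in L^1(\mathbb{T})$ with $\int_{\mathbb{T}}g=1$, and $\mu_g$ is the probability measure with $d\mu_g=g\,dx$. Given $\{\ell_n\}$, let $\{\omega_n\}$ be i.i.d. random variables on $\mathbb{T}$ with distribution $\mu_g$ and $I_n=(\omega_n-\ell_n/2,\ \omega_n+\ell_n/2)\subset\mathbb{T}$. The circle is $\mu_g$-Dvoretzky covered for $\{\ell_n\}$ if almost surely $\mathbb{T}=\limsup_{n\to\infty}I_n$, i.e. almost surely every point of $\mathbb{T}$ lies in infinitely many $I_n$. For a measurable set $J\subset\mathbb{T}$ with $|J|>0$, $\mathrm{ess\,inf}_J g=\sup\{a\in\mathbb{R}: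 g(x)\ge a \text{ for Lebesgue a.e. } x\in J\}$. Put $m_g=\mathrm{ess\,inf}_{\mathbb{T}}g$ and $K_g=\{x\in\mathbb{T}:\lim_{n\to\infty}\mathrm{ess\,inf}_{B(x,1/n)}g=m_g\}$, where $B(x,r)$ is the ball of radius $r$ centered at $x$. *)

theory Defs
  imports "HOL-Probability.Probability"
begin

text \<open>
  The circle \<open>\<real>/\<int>\<close> is represented by its fundamental domain \<open>[0,1)\<close>; the projection of the real
  line onto the circle is then \<^const>\<open>frac\<close>. Functions on the circle are functions of
  type \<^typ>\<open>real \<Rightarrow> real\<close>, whose values outside \<open>[0,1)\<close> play no role.
\<close>

definition circle :: "real set" where
  "circle = {0..<1}"

definition circle_measure :: "real measure" where
  "circle_measure = lebesgue_on circle"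

text \<open>The quotient metric: the distance of \<open>x - y\<close> to the nearest integer.\<close>

definition circle_dist :: "real \<Rightarrow> real \<Rightarrow> real" where
  "circle_dist x y = infdist (x - y) \<int>"

definition circle_ball :: "real \<Rightarrow> real \<Rightarrow> real set" where
  "circle_ball x r = {y \<in> circle. circle_dist x y < r}"

definition circle_arc :: "real \<Rightarrow> real \<Rightarrow> real set" where
  "circle_arc c l = frac ` {c - l/2 <..< c + l/2}"

definition circle_pdf :: "(real \<Rightarrow> real) \<Rightarrow> bool" where
  "circle_pdf g \<longleftrightarrow> (\<forall>x\<in>circle. 0 \<le> g x) \<and> integrable circle_measure g
     \<and> integral\<^sup>L circle_measure g = 1"

text \<open>
  The density is only Lebesgue measurable, whereas the law of a random point is taken on the
  Borel sets of the circle; hence the transport along the identity.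
\<close>

definition law :: "(real \<Rightarrow> real) \<Rightarrow> real measure" where
  "law g = distr (density circle_measure (\<lambda>x. ennreal (g x))) (restrict_space borel circle) (\<lambda>x. x)"

text \<open>
  The supremum is taken in \<^typ>\<open>real\<close>: for \<open>J\<close> of positive measure and nonnegative \<open>g\<close>
  the set below is nonempty and bounded above.
\<close>

definition ess_inf :: "real set \<Rightarrow> (real \<Rightarrow> real) \<Rightarrow> real" where
  "ess_inf J g = Sup {a. AE x in circle_measure. x \<in> J \<longrightarrow> a \<le> g x}"

definition min_val :: "(real \<Rightarrow> real) \<Rightarrow> real" where
  "min_val g = ess_inf circle g"

definition min_set :: "(real \<Rightarrow> real) \<Rightarrow> real set" where
  "min_set g = {x \<in> circle. (\<lambda>n. ess_inf (circle_ball x (1 / real n)) g) \<longlonglongrightarrow> min_val g}"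

text \<open>
  The i.i.d. sequence is the coordinate process on the product space; lengths and random
  points are indexed from 1. Lemma \<open>dvoretzky_covered_iid\<close> below transfers the
  property to i.i.d. sequences on arbitrary probability spaces.
\<close>

definition dvoretzky_covered :: "(real \<Rightarrow> real) \<Rightarrow> (nat \<Rightarrow> real) \<Rightarrow> bool" where
  "dvoretzky_covered g L \<longleftrightarrow>
     (AE \<omega> in (\<Pi>\<^sub>M n\<in>{1..}. law g). circle = limsup (\<lambda>n. circle_arc (\<omega> n) (L n)))"

lemma id_measurable_circle:
  "(\<lambda>x. x) \<in> density circle_measure h \<rightarrow>\<^sub>M restrict_space borel circle"
proof -
  have "(\<lambda>x. x) \<in> lebesgue_on circle \<rightarrow>\<^sub>M borel"
    by (intro measurable_restrict_space1 measurable_completion) simp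
  then show ?thesis
    by (auto simp: circle_measure_def intro!: measurable_restrict_space2)
qed

lemma prob_space_law:
  assumes "circle_pdf g"
  shows "prob_space (law g)"
proof -
  have nn: "AE x in circle_measure. 0 \<le> g x"
    using assms by (auto simp: circle_pdf_def circle_measure_def)
  have "(\<integral>\<^sup>+x. ennreal (g x) \<partial>circle_measure) = 1"
    using assms nn by (simp add: circle_pdf_def nn_integral_eq_integral)
  then have "prob_space (density circle_measure (\<lambda>x. ennreal (g x)))"
    using assms by (intro prob_spaceI) (auto simp: circle_pdf_def emeasure_density nn_integral_restrict_space cong: nn_integral_cong)
  then show ?thesis
    unfolding law_def by (intro prob_space.prob_space_distr id_measurable_circle)
qed

lemma dvoretzky_covered_iid:
  fixes X :: "nat \<Rightarrow> 'a \<Rightarrow> real"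
  assumes "prob_space M"
    and indep: "prob_space.indep_vars M (\<lambda>_. restrict_space borel circle) X {1..}"
    and law: "\<And>n. n \<ge> 1 \<Longrightarrow> distr M (restrict_space borel circle) (X n) = law g"
    and cov: "dvoretzky_covered g L"
  shows "AE w in M. circle = limsup (\<lambda>n. circle_arc (X n w) (L n))"
proof -
  interpret prob_space M by fact
  have rv: "X n \<in> M \<rightarrow>\<^sub>M restrict_space borel circle" if "n \<in> {1..}" for n
    using indep that by (auto simp: indep_vars_def)
  let ?P = "\<Pi>\<^sub>M n\<in>{1..}. restrict_space borel circle"
  let ?Y = "\<lambda>w. \<lambda>n\<in>{1..}. X n w"
  have "distr M ?P ?Y = (\<Pi>\<^sub>M n\<in>{1..}. distr M (restrict_space borel circle) (X n))"
    using indep_vars_iff_distr_eq_PiM'[where I = "{1..}" and X = X and M' = "\<lambda>_. restrict_space borel circle"]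
      rv indep by auto
  also have "\<dots> = (\<Pi>\<^sub>M n\<in>{1..}. law g)"
    using law by (intro PiM_cong) auto
  finally have eq: "distr M ?P ?Y = (\<Pi>\<^sub>M n\<in>{1..}. law g)" .
  have Y: "?Y \<in> M \<rightarrow>\<^sub>M ?P"
    using rv by (intro measurable_restrict) auto
  have "AE w in M. circle = limsup (\<lambda>n. circle_arc (?Y w n) (L n))"
    using cov unfolding dvoretzky_covered_def eq[symmetric] by (rule AE_distrD[OF Y])
  moreover have "limsup (\<lambda>n. circle_arc (?Y w n) (L n)) = limsup (\<lambda>n. circle_arc (X n w) (L n))" for w
    by (intro Limsup_eq eventually_mono[OF eventually_ge_at_top[of 1]]) auto
  ultimately show ?thesis by simp
qed

end

theory Submission
  imports Defs
begin

text \<open>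
  Off \<open>K = min_set f\<close> the density is locally at least \<open>c > min_val f\<close>. Along a sequence of \<open>n\<close>
  with \<open>c (\<ell>\<^sub>1 + \<dots> + \<ell>\<^sub>n) - ln n \<rightarrow> \<infinity>\<close>, a union bound over \<open>n\<close> points at mesh \<open>1/n\<close> shows that the first
  \<open>n\<close> arcs miss some point with probability tending to \<open>0\<close>. So any density with the same minimum and
  minimal set covers the complement of \<open>K\<close>, and the same argument covers \<open>K\<close> itself as soon as every
  small ball centred in \<open>K\<close> has mass at least \<open>2 c r\<close> for some \<open>c > min_val f\<close>.

  To get this, \<open>f\<close> is replaced on a thin neighbourhood of \<open>K\<close> by \<open>min_val f + 1\<close>, except on an open
  set \<open>Z\<close> where it is set to \<open>min_val f\<close> plus the distance to \<open>K\<close>. The set \<open>Z\<close> accumulates at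
  every point of \<open>K\<close>, which keeps the minimal set unchanged, but fills at most half of every ball
  centred in \<open>K\<close>. The change of total mass is absorbed by a small constant on a set
  where \<open>f\<close> is well above its minimum.
\<close>

section \<open>Geometry of the circle\<close>

text \<open>An infimum is strictly below \<open>r\<close> exactly when some term is, so strict
  bounds come with a witness integer. The distance arguments below work with this form.\<close>

lemma circle_dist_less_iff: "circle_dist x y < r \<longleftrightarrow> (\<exists>n::int. \<bar>x - y - of_int n\<bar> < r)"
proof -
  have "circle_dist x y = (INF a\<in>\<int>. dist (x - y) a)"
    unfolding circle_dist_def by (rule infdist_notempty) (use Ints_0 in blast)
  moreover have "(INF a\<in>(\<int>::real set). dist (x - y) a) < r \<longleftrightarrow> (\<exists>a\<in>\<int>. dist (x - y) a < r)"
    by (rule cINF_less_iff) (use Ints_0 in blast, auto intro!: bdd_belowI[of _ 0])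
  ultimately show ?thesis
    by (auto simp: dist_real_def elim!: Ints_cases)
qed

lemma circle_dist_triangle_less:
  assumes "circle_dist x y < r" "circle_dist y z < s"
  shows "circle_dist x z < r + s"
proof -
  obtain m n :: int where "\<bar>x - y - of_int m\<bar> < r" "\<bar>y - z - of_int n\<bar> < s"
    using assms unfolding circle_dist_less_iff by blast
  then have "\<bar>x - z - of_int (m + n)\<bar> < r + s" by simp
  then show ?thesis unfolding circle_dist_less_iff by blast
qed

lemma circle_dist_commute: "circle_dist x y = circle_dist y x"
proof -
  have "circle_dist a b < r \<Longrightarrow> circle_dist b a < r" for a b r
  proof -
    assume "circle_dist a b < r"
    then obtain n :: int where "\<bar>a - b - of_int n\<bar> < r"
      unfolding circle_dist_less_iff by blast
    then have "\<bar>b - a - of_int (- n)\<bar> < r" by simp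
    then show ?thesis unfolding circle_dist_less_iff by blast
  qed
  then show ?thesis by (meson linorder_neqE_linordered_idom order_less_irrefl)
qed

lemma circle_dist_less_abs: "\<bar>x - y\<bar> < r \<Longrightarrow> circle_dist x y < r"
  unfolding circle_dist_less_iff by (rule exI[of _ 0]) simp

text \<open>The witness integer lifts \<open>y\<close> into the real interval around
  \<open>c\<close>, and \<open>frac\<close> undoes the lift.\<close>

lemma circle_arcI:
  assumes "y \<in> circle" "circle_dist c y < l / 2"
  shows "y \<in> circle_arc c l"
proof -
  obtain n :: int where "\<bar>c - y - of_int n\<bar> < l / 2"
    using assms(2) unfolding circle_dist_less_iff by blast
  then have "y + of_int n \<in> {c - l/2 <..< c + l/2}"
    unfolding greaterThanLessThan_iff by linarith
  moreover have "frac (y + of_int n) = y"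
    using assms(1) by (simp add: circle_def frac_eq)
  ultimately show ?thesis unfolding circle_arc_def by (metis image_eqI)
qed

lemma circle_arc_subset: "circle_arc c l \<subseteq> circle"
  by (auto simp: circle_arc_def circle_def frac_lt_1)

lemma circle_ball_subset: "circle_ball x r \<subseteq> circle"
  by (auto simp: circle_ball_def)

lemma circle_ball_borel [measurable]: "circle_ball x r \<in> sets borel"
proof -
  have "circle_ball x r = circle \<inter> {y. circle_dist x y < r}" by (auto simp: circle_ball_def)
  moreover have "open {y. circle_dist x y < r}"
    unfolding circle_dist_def by (intro open_Collect_less continuous_intros)
  ultimately show ?thesis by (auto simp: circle_def)
qed

lemma space_circle_measure [simp]: "space circle_measure = circle"
  by (simp add: circle_measure_def)

lemma sets_circle_measureI: "A \<in> sets borel \<Longrightarrow> A \<subseteq> circle \<Longrightarrow> A \<in> sets circle_measure"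
  by (auto simp: circle_measure_def circle_def sets_restrict_space_iff)

lemma borel_measurable_circle: "g \<in> borel_measurable borel \<Longrightarrow> g \<in> borel_measurable circle_measure"
  unfolding circle_measure_def
  by (intro measurable_restrict_space1 measurable_completion) simp

lemma emeasure_circle_measure:
  assumes "A \<in> sets borel" "A \<subseteq> circle"
  shows "emeasure circle_measure A = emeasure lborel A"
  using assms by (simp add: circle_measure_def emeasure_restrict_space circle_def)

lemma circle_ball_measurable [measurable]: "circle_ball x r \<in> sets circle_measure"
  by (intro sets_circle_measureI circle_ball_borel circle_ball_subset)

lemma finite_measure_circle: "finite_measure circle_measure"
  by (rule finite_measureI) (simp add: emeasure_circle_measure[unfolded circle_def] circle_def)

lemma measure_circle [simp]: "measure circle_measure circle = 1"
  by (simp add: measure_def emeasure_circle_measure circle_def)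

text \<open>A ball that crosses the cut of the fundamental domain splits into two intervals. Each
  case exhibits two open intervals, one possibly empty, of total length \<open>2 * r\<close>;
  \<open>r \<le> 1/2\<close> makes them disjoint.\<close>

lemma measure_circle_ball_ge:
  assumes x: "x \<in> circle" and r: "0 < r" "r \<le> 1/2"
  shows "2 * r \<le> measure circle_measure (circle_ball x r)"
proof -
  interpret finite_measure circle_measure by (rule finite_measure_circle)
  have *: "2 * r \<le> measure circle_measure (circle_ball x r)"
    if s: "{a<..<b} \<union> {c<..<d} \<subseteq> circle_ball x r" and "a \<le> b" "b \<le> c" "c \<le> d" "(b - a) + (d - c) = 2 * r"
    for a b c d :: real
  proof -
    have "{a<..<b} \<union> {c<..<d} \<subseteq> circle" using s circle_ball_subset by blast
    then have "emeasure circle_measure ({a<..<b} \<union> {c<..<d}) = emeasure lborel ({a<..<b} \<union> {c<..<d})"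
      by (intro emeasure_circle_measure) auto
    also have "\<dots> = emeasure lborel {a<..<b} + emeasure lborel {c<..<d}"
      using that by (intro plus_emeasure[symmetric]) auto
    also have "\<dots> = ennreal (2 * r)"
      using that r by (simp add: ennreal_plus[symmetric] del: ennreal_plus)
    finally have "measure circle_measure ({a<..<b} \<union> {c<..<d}) = 2 * r"
      using r by (simp add: measure_def)
    then show ?thesis using finite_measure_mono[OF s] by simp
  qed
  have in_ball: "y \<in> circle_ball x r" if "0 \<le> y" "y < 1" "\<bar>x - y - of_int n\<bar> < r" for y n
    using that by (auto simp: circle_ball_def circle_def circle_dist_less_iff)
  consider "x < r" | "1 < x + r" | "r \<le> x" "x + r \<le> 1" by linarith
  then show ?thesis
  proof cases
    case 1
    have "y \<in> circle_ball x r" if "y \<in> {0<..<x + r} \<union> {1 + x - r<..<1}" for y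
      using that
    proof
      assume "y \<in> {0<..<x + r}"
      then show ?thesis using in_ball[of y 0] 1 r x by (auto simp: circle_def)
    next
      assume "y \<in> {1 + x - r<..<1}"
      then show ?thesis using in_ball[of y "-1"] 1 r x by (auto simp: circle_def)
    qed
    then show ?thesis using 1 r x by (intro *[of 0 "x + r" "1 + x - r" 1]) (auto simp: circle_def)
  next
    case 2
    have "y \<in> circle_ball x r" if "y \<in> {0<..<x + r - 1} \<union> {x - r<..<1}" for y
      using that
    proof
      assume "y \<in> {0<..<x + r - 1}"
      then show ?thesis using in_ball[of y 1] 2 r x by (auto simp: circle_def)
    next
      assume "y \<in> {x - r<..<1}"
      then show ?thesis using in_ball[of y 0] 2 r x by (auto simp: circle_def)
    qed
    then show ?thesis using 2 r x by (intro *[of 0 "x + r - 1" "x - r" 1]) (auto simp: circle_def)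
  next
    case 3
    have "y \<in> circle_ball x r" if "y \<in> {x - r<..<x + r} \<union> {x + r<..<x + r}" for y
      using in_ball[of y 0] 3 that by auto
    then show ?thesis using 3 r by (intro *[of "x - r" "x + r" "x + r" "x + r"]) auto
  qed
qed

lemma interval_in_circle_ball:
  assumes "x \<in> circle" "0 < r"
  obtains a b where "a < b" "{a<..<b} \<subseteq> circle_ball x r"
proof
  show "x < min (x + r) 1" using assms by (auto simp: circle_def)
  show "{x<..<min (x + r) 1} \<subseteq> circle_ball x r"
    using assms by (auto simp: circle_def circle_ball_def intro!: circle_dist_less_abs)
qed

section \<open>Essential infimum and minimal set\<close>

lemma circle_ball_mono: "r \<le> s \<Longrightarrow> circle_ball x r \<subseteq> circle_ball x s"
  by (auto simp: circle_ball_def)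

lemma circle_ball_not_null:
  assumes "x \<in> circle" "0 < r"
  shows "circle_ball x r \<notin> null_sets circle_measure"
proof
  assume "circle_ball x r \<in> null_sets circle_measure"
  then have "circle_ball x (min r (1/2)) \<in> null_sets circle_measure"
    by (rule null_sets_subset) (auto intro: circle_ball_mono[THEN subsetD, rotated])
  then have "measure circle_measure (circle_ball x (min r (1/2))) = 0"
    by (simp add: measure_eq_0_null_sets)
  moreover have "2 * min r (1/2) \<le> measure circle_measure (circle_ball x (min r (1/2)))"
    using assms by (intro measure_circle_ball_ge) auto
  moreover have "0 < min r (1/2)" using assms by simp
  ultimately show False by linarith
qed

lemma circle_not_null: "circle \<notin> null_sets circle_measure"
  using measure_circle measure_eq_0_null_sets by fastforce

text \<open>A real \<open>Sup\<close> is informative only over a set bounded above. If the set were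
  unbounded, almost every point of \<open>J\<close> would have \<open>g x\<close> above all natural
  numbers, so \<open>J\<close> would be null.\<close>

lemma ess_inf_bdd_above:
  fixes g :: "real \<Rightarrow> real"
  assumes "J \<in> sets circle_measure" "J \<notin> null_sets circle_measure"
  shows "bdd_above {a. AE x in circle_measure. x \<in> J \<longrightarrow> a \<le> g x}"
proof (rule ccontr)
  assume unb: "\<not> ?thesis"
  have "AE x in circle_measure. x \<in> J \<longrightarrow> real n \<le> g x" for n
  proof -
    obtain a where "AE x in circle_measure. x \<in> J \<longrightarrow> a \<le> g x" "real n < a"
      using unb by (auto simp: bdd_above_def not_le)
    then show ?thesis by (auto elim!: eventually_mono)
  qed
  then have "AE x in circle_measure. \<forall>n. x \<in> J \<longrightarrow> real n \<le> g x"
    unfolding AE_all_countable by blast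
  then have "AE x in circle_measure. x \<notin> J"
    by eventually_elim (meson not_less reals_Archimedean2)
  with assms show False
    by (simp add: AE_iff_null_sets)
qed

lemma le_ess_inf:
  assumes "J \<in> sets circle_measure" "J \<notin> null_sets circle_measure"
    and "AE x in circle_measure. x \<in> J \<longrightarrow> a \<le> g x"
  shows "a \<le> ess_inf J g"
  unfolding ess_inf_def using assms by (intro cSup_upper ess_inf_bdd_above) auto

text \<open>Nonnegativity puts 0 among the essential lower bounds, so the real \<open>Sup\<close>
  runs over a nonempty set.\<close>

lemma ess_inf_le:
  assumes "\<And>x. x \<in> circle \<Longrightarrow> 0 \<le> g x"
    and "\<And>a. AE x in circle_measure. x \<in> J \<longrightarrow> a \<le> g x \<Longrightarrow> a \<le> c"
  shows "ess_inf J g \<le> c"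
  unfolding ess_inf_def
proof (rule cSup_least)
  have "0 \<in> {a. AE x in circle_measure. x \<in> J \<longrightarrow> a \<le> g x}"
    using assms(1) by (auto intro!: AE_I2)
  then show "{a. AE x in circle_measure. x \<in> J \<longrightarrow> a \<le> g x} \<noteq> {}" by blast
qed (use assms(2) in auto)

text \<open>Every value below the supremum is an essential lower bound. Countably many such values
  approach the supremum, and their exceptional null sets have a null union.\<close>

lemma AE_ess_inf_le:
  assumes "\<And>x. x \<in> circle \<Longrightarrow> 0 \<le> g x"
  shows "AE x in circle_measure. x \<in> J \<longrightarrow> ess_inf J g \<le> g x"
proof -
  have "AE x in circle_measure. x \<in> J \<longrightarrow> ess_inf J g - 1 / real (Suc n) \<le> g x" for n
  proof (rule ccontr)
    assume *: "\<not> ?thesis"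
    have "ess_inf J g \<le> ess_inf J g - 1 / real (Suc n)"
    proof (rule ess_inf_le[of g, OF assms])
      fix a assume a: "AE x in circle_measure. x \<in> J \<longrightarrow> a \<le> g x"
      show "a \<le> ess_inf J g - 1 / real (Suc n)"
      proof (rule ccontr)
        assume "\<not> ?thesis"
        with a have "AE x in circle_measure. x \<in> J \<longrightarrow> ess_inf J g - 1 / real (Suc n) \<le> g x"
          by (auto elim!: eventually_mono)
        with * show False by blast
      qed
    qed
    then show False by simp
  qed
  then have "AE x in circle_measure. \<forall>n. x \<in> J \<longrightarrow> ess_inf J g - 1 / real (Suc n) \<le> g x"
    unfolding AE_all_countable by blast
  then show ?thesis
  proof eventually_elim
    case (elim x)
    show ?case
    proof (rule impI, rule field_le_epsilon)
      fix e :: real assume "x \<in> J" "0 < e"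
      then obtain n where n: "1 / real (Suc n) < e" using nat_approx_posE by blast
      have "ess_inf J g - 1 / real (Suc n) \<le> g x" using elim \<open>x \<in> J\<close> by blast
      with n show "ess_inf J g \<le> g x + e" by linarith
    qed
  qed
qed

lemma min_val_nonneg:
  assumes "\<And>x. x \<in> circle \<Longrightarrow> 0 \<le> g x"
  shows "0 \<le> min_val g"
  unfolding min_val_def using assms sets.top[of circle_measure]
  by (intro le_ess_inf circle_not_null) auto

lemma AE_min_val_le:
  assumes "\<And>x. x \<in> circle \<Longrightarrow> 0 \<le> g x"
  shows "AE x in circle_measure. min_val g \<le> g x"
proof -
  have "AE x in circle_measure. x \<in> circle" using AE_space[of circle_measure] by simp
  moreover have "AE x in circle_measure. x \<in> circle \<longrightarrow> min_val g \<le> g x"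
    unfolding min_val_def using assms by (rule AE_ess_inf_le)
  ultimately show ?thesis by eventually_elim blast
qed

text \<open>Essential infima over balls never drop below \<open>min_val g\<close> and only grow as
  the ball shrinks, so a single ball detects the failure of convergence. This local form replaces
  the limit from here on.\<close>

lemma not_in_min_set_iff:
  assumes nn: "\<And>x. x \<in> circle \<Longrightarrow> 0 \<le> g x" and x: "x \<in> circle"
  shows "x \<notin> min_set g \<longleftrightarrow>
    (\<exists>r>0. \<exists>a>min_val g. AE y in circle_measure. y \<in> circle_ball x r \<longrightarrow> a \<le> g y)"
proof
  assume "x \<notin> min_set g"
  show "\<exists>r>0. \<exists>a>min_val g. AE y in circle_measure. y \<in> circle_ball x r \<longrightarrow> a \<le> g y"
  proof (rule ccontr)
    assume *: "\<not> ?thesis"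
    \<comment> \<open>At \<open>n = 0\<close> the radius is \<open>1 / 0 = 0\<close> and the ball is
      empty, so that index is left out.\<close>
    have "ess_inf (circle_ball x (1 / real n)) g = min_val g" if "n \<ge> 1" for n
    proof (rule antisym)
      show "ess_inf (circle_ball x (1 / real n)) g \<le> min_val g"
      proof (rule ess_inf_le[of g, OF nn])
        fix a assume "AE y in circle_measure. y \<in> circle_ball x (1 / real n) \<longrightarrow> a \<le> g y"
        moreover have "0 < 1 / real n" using that by simp
        ultimately show "a \<le> min_val g" using * by (meson not_less)
      qed
      show "min_val g \<le> ess_inf (circle_ball x (1 / real n)) g"
        using AE_min_val_le[of g] nn that x
        by (intro le_ess_inf circle_ball_not_null) (auto elim: eventually_mono)
    qed
    then have "eventually (\<lambda>n. ess_inf (circle_ball x (1 / real n)) g = min_val g) sequentially"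
      by (auto simp: eventually_sequentially)
    then have "x \<in> min_set g" using x by (auto simp: min_set_def intro: tendsto_eventually)
    with \<open>x \<notin> min_set g\<close> show False by blast
  qed
next
  assume "\<exists>r>0. \<exists>a>min_val g. AE y in circle_measure. y \<in> circle_ball x r \<longrightarrow> a \<le> g y"
  then obtain r a where r: "r > 0" and a: "a > min_val g"
    and ae: "AE y in circle_measure. y \<in> circle_ball x r \<longrightarrow> a \<le> g y" by blast
  obtain n0 where n0: "1 / real (Suc n0) < r" using nat_approx_posE[OF r] by blast
  have "a \<le> ess_inf (circle_ball x (1 / real n)) g" if "n \<ge> Suc n0" for n
  proof (rule le_ess_inf)
    have "1 / real n \<le> 1 / real (Suc n0)" using that by (intro divide_left_mono) auto
    with n0 have "circle_ball x (1 / real n) \<subseteq> circle_ball x r" by (intro circle_ball_mono) simp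
    with ae show "AE y in circle_measure. y \<in> circle_ball x (1 / real n) \<longrightarrow> a \<le> g y"
      by (auto elim: eventually_mono)
    show "circle_ball x (1 / real n) \<notin> null_sets circle_measure"
      using that x by (intro circle_ball_not_null) auto
  qed simp
  then have "a \<le> l" if "(\<lambda>n. ess_inf (circle_ball x (1 / real n)) g) \<longlonglongrightarrow> l" for l
    using LIMSEQ_le_const[OF that] by blast
  with a show "x \<notin> min_set g" unfolding min_set_def mem_Collect_eq by (meson not_le)
qed

section \<open>Masses of Borel sets under the law of a random point\<close>

lemma measure_law:
  assumes g: "circle_pdf g" and B: "B \<in> sets borel" "B \<subseteq> circle"
  shows "measure (law g) B = (\<integral>y. indicator B y * g y \<partial>circle_measure)"
proof -
  have [measurable]: "g \<in> borel_measurable circle_measure" "B \<in> sets circle_measure"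
    using g B sets_circle_measureI by (auto simp: circle_pdf_def)
  have int: "integrable circle_measure (\<lambda>y. indicator B y * g y)"
    using integrable_mult_indicator[of B circle_measure g] g by (simp add: circle_pdf_def)
  have "B \<in> sets (restrict_space borel circle)"
    using B by (simp add: sets_restrict_space_iff circle_def)
  then have "emeasure (law g) B = emeasure (density circle_measure (\<lambda>x. ennreal (g x))) B"
    unfolding law_def using B by (subst emeasure_distr[OF id_measurable_circle]) (auto simp: Int_absorb2)
  also have "\<dots> = (\<integral>\<^sup>+y. ennreal (g y) * indicator B y \<partial>circle_measure)"
    by (intro emeasure_density) auto
  also have "\<dots> = (\<integral>\<^sup>+y. ennreal (indicator B y * g y) \<partial>circle_measure)"
    by (intro nn_integral_cong) (auto split: split_indicator)
  also have "\<dots> = ennreal (\<integral>y. indicator B y * g y \<partial>circle_measure)"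
    using g by (intro nn_integral_eq_integral int) (auto simp: circle_pdf_def)
  finally have "emeasure (law g) B = ennreal (\<integral>y. indicator B y * g y \<partial>circle_measure)" .
  moreover have "0 \<le> (\<integral>y. indicator B y * g y \<partial>circle_measure)"
    using g by (intro integral_nonneg_AE) (auto simp: circle_pdf_def)
  ultimately show ?thesis by (simp add: measure_def)
qed

text \<open>\<open>C\<close> carries an excess of 1 over the base level \<open>a\<close>. It is
  empty when centres off the minimal set are treated, and it is the part of a ball outside
  \<open>Z\<close> for centres in the minimal set.\<close>

lemma measure_law_ge:
  assumes g: "circle_pdf g" and B: "B \<in> sets borel" "B \<subseteq> circle"
    and C: "C \<in> sets circle_measure" "C \<subseteq> B"
    and ge: "AE y in circle_measure. y \<in> B \<longrightarrow> a + indicator C y \<le> g y"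
  shows "a * measure circle_measure B + measure circle_measure C \<le> measure (law g) B"
proof -
  interpret finite_measure circle_measure by (rule finite_measure_circle)
  have [measurable]: "B \<in> sets circle_measure" using B by (rule sets_circle_measureI)
  have "a * measure circle_measure B + measure circle_measure C
      = (\<integral>y. a * indicator B y + indicator C y \<partial>circle_measure)"
    using C B by (subst Bochner_Integration.integral_add) (auto simp: Int_absorb2 emeasure_eq_measure)
  also have "\<dots> \<le> (\<integral>y. indicator B y * g y \<partial>circle_measure)"
  proof (rule integral_mono_AE)
    show "integrable circle_measure (\<lambda>y. indicator B y * g y)"
      using integrable_mult_indicator[of B circle_measure g] g by (simp add: circle_pdf_def)
    show "AE y in circle_measure. a * indicator B y + indicator C y \<le> indicator B y * g y"
      using ge by eventually_elim (use C in \<open>auto split: split_indicator\<close>)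
  qed (use C in \<open>auto simp: emeasure_eq_measure\<close>)
  finally show ?thesis using measure_law[OF g B] by simp
qed

section \<open>Covering by random arcs\<close>

lemma space_law [simp]: "space (law g) = circle"
  by (simp add: law_def space_restrict_space)

lemma sets_law [simp]: "sets (law g) = sets (restrict_space borel circle)"
  by (simp add: law_def)

text \<open>Lengths are truncated because ball masses are controlled only for small radii. Either
  the lengths eventually drop to \<open>s\<close>, and truncation alters finitely many terms, or
  every term from \<open>N\<close> on is truncated to \<open>s\<close> and the sum grows
  linearly.\<close>

lemma truncated_sum_exceeds_ln:
  fixes L :: "nat \<Rightarrow> real"
  assumes anti: "antimono_on {1..} L" and c: "0 < c" and s: "0 < s" and N: "1 \<le> N"
    and q: "1 < c * q" "\<exists>\<^sub>F n in sequentially. q * ln (real n) \<le> (\<Sum>k=1..n. L k)"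
    and pos: "\<And>n. 1 \<le> n \<Longrightarrow> 0 < L n"
  shows "\<exists>n\<ge>N. ln (real n) + B \<le> c * (\<Sum>k=N..n. min (L k) s)"
proof (cases "\<exists>k\<ge>N. L k \<le> s")
  case True
  then obtain k0 where k0: "N \<le> k0" "L k0 \<le> s" by blast
  \<comment> \<open>\<open>D\<close> bounds what the initial terms contribute to the untruncated
    sum. The threshold on \<open>ln (real n)\<close> lets the surplus
    \<open>(c * q - 1) * ln (real n)\<close> pay for both \<open>B\<close> and
    \<open>c * D\<close>.\<close>
  define D where "D = (\<Sum>k=1..<k0. L k)"
  have "filterlim (\<lambda>n. ln (real n)) at_top sequentially"
    by (rule filterlim_compose[OF ln_at_top filterlim_real_sequentially])
  then have "\<forall>\<^sub>F n in sequentially. (B + c * D) / (c * q - 1) \<le> ln (real n)"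
    by (simp add: filterlim_at_top)
  then have "\<forall>\<^sub>F n in sequentially. k0 \<le> n \<and> (B + c * D) / (c * q - 1) \<le> ln (real n)"
    by (intro eventually_conj eventually_ge_at_top)
  then have "\<exists>\<^sub>F n in sequentially. (k0 \<le> n \<and> (B + c * D) / (c * q - 1) \<le> ln (real n)) \<and>
      q * ln (real n) \<le> (\<Sum>k=1..n. L k)"
    using q(2) by (intro frequently_eventually_conj)
  then obtain n where n: "q * ln (real n) \<le> (\<Sum>k=1..n. L k)" "k0 \<le> n"
    "(B + c * D) / (c * q - 1) \<le> ln (real n)"
    by (blast dest: frequently_ex)
  have "(\<Sum>k=1..n. L k) = D + (\<Sum>k=k0..n. L k)"
    unfolding D_def using k0 N n(2)
    by (subst sum.union_disjoint[symmetric]) (auto intro!: sum.cong)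
  also have "(\<Sum>k=k0..n. L k) = (\<Sum>k=k0..n. min (L k) s)"
  proof (rule sum.cong)
    fix k assume "k \<in> {k0..n}"
    then have "L k \<le> L k0" using k0 N by (intro monotone_onD[OF anti]) auto
    then show "L k = min (L k) s" using k0 by simp
  qed simp
  also have "\<dots> \<le> (\<Sum>k=N..n. min (L k) s)"
    using k0 N s pos by (intro sum_mono2) (auto simp: less_imp_le)
  finally have "q * ln (real n) \<le> D + (\<Sum>k=N..n. min (L k) s)" using n(1) by simp
  then have "c * (q * ln (real n)) \<le> c * (D + (\<Sum>k=N..n. min (L k) s))"
    using c by (intro mult_left_mono) auto
  moreover have "B + c * D \<le> (c * q - 1) * ln (real n)"
    using n(3) q(1) by (simp add: pos_divide_le_eq mult.commute)
  ultimately have "ln (real n) + B \<le> c * (\<Sum>k=N..n. min (L k) s)"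
    by (simp add: algebra_simps)
  then show ?thesis using k0 n(2) by (intro exI[of _ n]) auto
next
  case False
  \<comment> \<open>The truncated sum times \<open>c\<close> is at least
    \<open>2 * a * (real n - real N)\<close>. One half of the slope dominates
    \<open>ln (real n)\<close> through \<open>ln_le_minus_one\<close>, the other absorbs the
    constants.\<close>
  define a where "a = c * s / 2"
  have a: "a > 0" using c s by (simp add: a_def)
  obtain n0 :: nat where n0: "(2 * a * real N - 1 - ln a + B) / a \<le> real n0"
    using real_arch_simple by blast
  define n where "n = max N n0"
  have n: "n \<ge> N" "n \<ge> 1" using N by (auto simp: n_def)
  have "(2 * a * real N - 1 - ln a + B) / a \<le> real n" using n0 by (simp add: n_def)
  then have *: "2 * a * real N - 1 - ln a + B \<le> a * real n"
    using a by (simp add: pos_divide_le_eq mult.commute)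
  have "ln (a * real n) \<le> a * real n - 1" using a n by (intro ln_le_minus_one) auto
  then have "ln (real n) \<le> a * real n - 1 - ln a" using a n by (simp add: ln_mult)
  with * have "ln (real n) + B \<le> 2 * a * (real n - real N)" by (simp add: algebra_simps)
  also have "\<dots> \<le> 2 * a * (real (n + 1 - N))" using a n by (intro mult_left_mono) auto
  also have "\<dots> = c * (\<Sum>k=N..n. s)" by (simp add: a_def)
  also have "(\<Sum>k=N..n. s) = (\<Sum>k=N..n. min (L k) s)"
  proof (rule sum.cong)
    fix k assume "k \<in> {N..n}"
    with False have "s < L k" by (meson atLeastAtMost_iff not_le)
    then show "s = min (L k) s" by simp
  qed simp
  finally show ?thesis using n by blast
qed

text \<open>For fixed \<open>N\<close>, if the arcs with index at least \<open>N\<close> leave a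
  point of \<open>F\<close> uncovered, then every event \<open>E n\<close> with
  \<open>n \<ge> N\<close> occurs. Only finitely many points of \<open>F\<close> enter
  \<open>E n\<close>, so it is measurable, and a union bound makes its probability small for
  suitable \<open>n\<close>.\<close>

lemma AE_subset_limsup_arcs:
  assumes g: "circle_pdf g" and anti: "antimono_on {1..} L" and pos: "\<And>n. 1 \<le> n \<Longrightarrow> 0 < L n"
    and c: "0 < c"
    and q: "1 < c * q" "\<exists>\<^sub>F n in sequentially. q * ln (real n) \<le> (\<Sum>k=1..n. L k)"
    and F: "F \<subseteq> circle" and r0: "0 < r0"
    and mass: "\<And>x r. x \<in> F \<Longrightarrow> 0 < r \<Longrightarrow> r \<le> r0 \<Longrightarrow> 2 * c * r \<le> measure (law g) (circle_ball x r)"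
  shows "AE \<omega> in (\<Pi>\<^sub>M n\<in>{1..}. law g). F \<subseteq> limsup (\<lambda>n. circle_arc (\<omega> n) (L n))"
proof -
  let ?P = "\<Pi>\<^sub>M n\<in>{1::nat..}. law g"
  interpret law: prob_space "law g" by (rule prob_space_law[OF g])
  interpret product_prob_space "\<lambda>_::nat. law g" "{1..}"
    by unfold_locales
  have "AE \<omega> in ?P. F \<subseteq> (\<Union>k\<in>{N..}. circle_arc (\<omega> k) (L k))" if N: "1 \<le> N" for N
  proof -
    \<comment> \<open>\<open>G n\<close> lists the cells of mesh \<open>1 / n\<close> that meet
      \<open>F\<close>. Each gets a representative \<open>p n i\<close> in \<open>F\<close> itself,
      since \<open>mass\<close> speaks only of centres in \<open>F\<close>. The radii
      \<open>\<rho> n k\<close> are reduced by \<open>1 / n\<close> so that hitting the small ball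
      around a representative covers the points of \<open>F\<close> in its cell.\<close>
    define G where "G n = {i. i < n \<and> (\<exists>x\<in>F. \<lfloor>real n * x\<rfloor> = int i)}" for n
    define p where "p n i = (SOME x. x \<in> F \<and> \<lfloor>real n * x\<rfloor> = int i)" for n i
    define \<rho> where "\<rho> n k = min (L k / 2) r0 - 1 / real n" for n k
    define E where "E n = (\<Union>i\<in>G n. {\<omega> \<in> space ?P. \<forall>k\<in>{N..n}. \<omega> k \<in> circle - circle_ball (p n i) (\<rho> n k)})" for n
    have p: "p n i \<in> F" "\<lfloor>real n * p n i\<rfloor> = int i" if "i \<in> G n" for n i
      using that someI_ex[of "\<lambda>x. x \<in> F \<and> \<lfloor>real n * x\<rfloor> = int i"] by (auto simp: G_def p_def)
    have B: "circle - circle_ball x r \<in> sets (law g)" "circle_ball x r \<in> sets (law g)" for x r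
      using circle_ball_borel[of x r] by (auto simp: sets_restrict_space_iff circle_def circle_ball_def)
    have miss_sets: "{\<omega> \<in> space ?P. \<forall>k\<in>{N..n}. \<omega> k \<in> circle - circle_ball x (r k)} \<in> sets ?P"
      for n x and r :: "nat \<Rightarrow> real"
      using N by (intro sets.sets_Collect_finite_All sets_Collect_single B) auto
    have E_sets [measurable]: "E n \<in> sets ?P" for n
      unfolding E_def
    proof (intro sets.finite_UN)
      show "finite (G n)" by (simp add: G_def)
      show "{\<omega> \<in> space ?P. \<forall>k\<in>{N..n}. \<omega> k \<in> circle - circle_ball (p n i) (\<rho> n k)} \<in> sets ?P" for i
        by (rule miss_sets)
    qed
    have meas_E: "measure ?P (E n) \<le> real n * exp (2 * c - c * (\<Sum>k=N..n. min (L k) (2 * r0)))"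
      if n: "N \<le> n" for n
    proof -
      have "measure ?P {\<omega> \<in> space ?P. \<forall>k\<in>{N..n}. \<omega> k \<in> circle - circle_ball (p n i) (\<rho> n k)}
          \<le> exp (2 * c - c * (\<Sum>k=N..n. min (L k) (2 * r0)))" if i: "i \<in> G n" for i
      proof -
        \<comment> \<open>Independence: the event is a cylinder in the product space, so its
          probability factorises.\<close>
        have "emeasure ?P {\<omega> \<in> space ?P. \<forall>k\<in>{N..n}. \<omega> k \<in> circle - circle_ball (p n i) (\<rho> n k)}
            = (\<Prod>k=N..n. emeasure (law g) (circle - circle_ball (p n i) (\<rho> n k)))"
          using N B by (intro emeasure_PiM_Collect) auto
        also have "\<dots> = ennreal (\<Prod>k=N..n. measure (law g) (circle - circle_ball (p n i) (\<rho> n k)))"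
          by (simp add: law.emeasure_eq_measure prod_ennreal)
        finally have "measure ?P {\<omega> \<in> space ?P. \<forall>k\<in>{N..n}. \<omega> k \<in> circle - circle_ball (p n i) (\<rho> n k)}
            = (\<Prod>k=N..n. measure (law g) (circle - circle_ball (p n i) (\<rho> n k)))"
          by (simp add: measure_def prod_nonneg)
        also have "\<dots> \<le> (\<Prod>k=N..n. exp (- (2 * c * \<rho> n k)))"
        proof (intro prod_mono conjI)
          fix k assume "k \<in> {N..n}"
          show "measure (law g) (circle - circle_ball (p n i) (\<rho> n k)) \<le> exp (- (2 * c * \<rho> n k))"
          \<comment> \<open>For a nonpositive radius the right side is at least 1 and the bound is
            trivial.\<close>
          proof (cases "0 < \<rho> n k")
            case True
            have "\<rho> n k \<le> r0" by (simp add: \<rho>_def min.coboundedI2 diff_le_eq add_increasing2)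
            have "measure (law g) (circle - circle_ball (p n i) (\<rho> n k))
                = 1 - measure (law g) (circle_ball (p n i) (\<rho> n k))"
              using law.prob_compl[OF B(2)] by simp
            also have "\<dots> \<le> 1 - 2 * c * \<rho> n k" using mass[OF p(1)[OF i] True \<open>\<rho> n k \<le> r0\<close>] by simp
            also have "\<dots> \<le> exp (- (2 * c * \<rho> n k))" using exp_ge_add_one_self[of "- (2 * c * \<rho> n k)"] by simp
            finally show ?thesis .
          next
            case False
            then have "0 \<le> - (2 * c * \<rho> n k)" using c by (simp add: mult_nonneg_nonpos not_less)
            then have "1 \<le> exp (- (2 * c * \<rho> n k))" by simp
            then show ?thesis using law.prob_le_1 order_trans by blast
          qed
        qed simp
        also have "\<dots> = exp (- (\<Sum>k=N..n. 2 * c * \<rho> n k))"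
          by (simp add: exp_sum[symmetric] sum_negf)
        also have "\<dots> \<le> exp (2 * c - c * (\<Sum>k=N..n. min (L k) (2 * r0)))"
        proof -
          \<comment> \<open>The reduction by \<open>1 / n\<close> costs
            \<open>2 * c / real n\<close> per index. As \<open>N \<ge> 1\<close> there are at most
            \<open>n\<close> indices, so the total cost is at most \<open>2 * c\<close>.\<close>
          have "(\<Sum>k=N..n. 2 * c * \<rho> n k) = (\<Sum>k=N..n. c * min (L k) (2 * r0) - 2 * c / real n)"
            using c by (intro sum.cong) (auto simp: \<rho>_def min_def algebra_simps)
          also have "\<dots> = c * (\<Sum>k=N..n. min (L k) (2 * r0)) - real (n + 1 - N) * (2 * c / real n)"
            by (simp add: sum_subtractf sum_distrib_left)
          finally have "(\<Sum>k=N..n. 2 * c * \<rho> n k)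
              = c * (\<Sum>k=N..n. min (L k) (2 * r0)) - real (n + 1 - N) * (2 * c / real n)" .
          moreover have "real (n + 1 - N) * (2 * c / real n) \<le> real n * (2 * c / real n)"
            using c N by (intro mult_right_mono) auto
          moreover have "real n * (2 * c / real n) = 2 * c" using N n by simp
          ultimately show ?thesis unfolding exp_le_cancel_iff by linarith
        qed
        finally show ?thesis .
      qed
      note bound = this
      have "measure ?P (E n) \<le> (\<Sum>i\<in>G n. measure ?P {\<omega> \<in> space ?P. \<forall>k\<in>{N..n}. \<omega> k \<in> circle - circle_ball (p n i) (\<rho> n k)})"
        unfolding E_def
      proof (rule finite_measure_subadditive_finite)
        show "finite (G n)" by (simp add: G_def)
        show "(\<lambda>i. {\<omega> \<in> space ?P. \<forall>k\<in>{N..n}. \<omega> k \<in> circle - circle_ball (p n i) (\<rho> n k)}) ` G n \<subseteq> sets ?P"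
          using miss_sets by blast
      qed
      also have "\<dots> \<le> real (card (G n)) * exp (2 * c - c * (\<Sum>k=N..n. min (L k) (2 * r0)))"
        using bound by (intro sum_bounded_above) auto
      also have "\<dots> \<le> real n * exp (2 * c - c * (\<Sum>k=N..n. min (L k) (2 * r0)))"
      proof (intro mult_right_mono)
        have "card (G n) \<le> card {..<n}" by (intro card_mono) (auto simp: G_def)
        then show "real (card (G n)) \<le> real n" by simp
      qed simp
      finally show ?thesis .
    qed
    have "measure ?P (\<Inter>n\<in>{N..}. E n) \<le> 0 + e" if e: "0 < e" for e :: real
    proof -
      \<comment> \<open>The constant \<open>2 * c - ln e\<close> is chosen so that \<open>n\<close>
        times the bound for one representative is at most \<open>e\<close>.\<close>
      obtain n where n: "N \<le> n" "ln (real n) + (2 * c - ln e) \<le> c * (\<Sum>k=N..n. min (L k) (2 * r0))"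
        using truncated_sum_exceeds_ln[OF anti c _ N q pos, of "2 * r0" "2 * c - ln e"] r0 by auto
      have "measure ?P (\<Inter>n\<in>{N..}. E n) \<le> measure ?P (E n)"
        using n(1) by (intro finite_measure_mono E_sets) blast
      also have "\<dots> \<le> real n * exp (2 * c - c * (\<Sum>k=N..n. min (L k) (2 * r0)))"
        using n(1) by (rule meas_E)
      also have "\<dots> \<le> real n * exp (ln e - ln (real n))"
        using n(2) by (intro mult_left_mono) auto
      also have "\<dots> = e" using e n(1) N by (simp add: exp_diff)
      finally show ?thesis by simp
    qed
    then have "measure ?P (\<Inter>n\<in>{N..}. E n) \<le> 0" by (rule field_le_epsilon)
    then have "emeasure ?P (\<Inter>n\<in>{N..}. E n) = 0"
      by (subst emeasure_eq_measure) (rule ennreal_neg)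
    moreover have "(\<Inter>n\<in>{N..}. E n) \<in> sets ?P"
      by (rule sets.countable_INT') (use E_sets in blast)+
    ultimately have "(\<Inter>n\<in>{N..}. E n) \<in> null_sets ?P" by (rule null_setsI)
    then have "AE \<omega> in ?P. \<omega> \<notin> (\<Inter>n\<in>{N..}. E n)" by (rule AE_not_in)
    then show ?thesis
      using AE_space
    proof eventually_elim
      case (elim \<omega>)
      then obtain n where n: "N \<le> n" "\<omega> \<notin> E n" by auto
      show ?case
      proof
        fix y assume y: "y \<in> F"
        then have y01: "0 \<le> y" "y < 1" using F by (auto simp: circle_def)
        have n0: "0 < real n" using n(1) N by simp
        \<comment> \<open>The cell of \<open>y\<close> has a representative not missed by some arc
          with index in \<open>{N..n}\<close>; its distance to \<open>y\<close> is below
          \<open>1 / n\<close>, which is the margin built into \<open>\<rho>\<close>.\<close>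
        define i where "i = nat \<lfloor>real n * y\<rfloor>"
        have i: "\<lfloor>real n * y\<rfloor> = int i" using y01 by (simp add: i_def)
        have "real n * y < real n" using y01 n0 by simp
        then have "i < n" using i y01 by linarith
        then have iG: "i \<in> G n" using i y by (auto simp: G_def)
        then obtain k where k: "k \<in> {N..n}" "\<omega> k \<notin> circle - circle_ball (p n i) (\<rho> n k)"
          using n(2) elim unfolding E_def by blast
        have "\<omega> k \<in> circle" using elim(2) k(1) N by (auto simp: space_PiM PiE_iff)
        then have "circle_dist (p n i) (\<omega> k) < \<rho> n k" using k(2) by (auto simp: circle_ball_def)
        moreover have "circle_dist y (p n i) < 1 / real n"
        proof (rule circle_dist_less_abs)
          have "\<bar>real n * y - real n * p n i\<bar> < 1" using i p(2)[OF iG] by linarith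
          then have "real n * \<bar>y - p n i\<bar> < 1" using n0 by (simp add: abs_mult right_diff_distrib[symmetric])
          then show "\<bar>y - p n i\<bar> < 1 / real n" using n0 by (simp add: field_simps)
        qed
        ultimately have "circle_dist y (\<omega> k) < 1 / real n + \<rho> n k"
          by (rule circle_dist_triangle_less[rotated])
        also have "\<dots> \<le> L k / 2" by (simp add: \<rho>_def)
        finally have "y \<in> circle_arc (\<omega> k) (L k)"
          using y F by (intro circle_arcI) (auto simp: circle_dist_commute)
        then show "y \<in> (\<Union>k\<in>{N..}. circle_arc (\<omega> k) (L k))" using k(1) by auto
      qed
    qed
  qed
  then have "AE \<omega> in ?P. \<forall>N. F \<subseteq> (\<Union>k\<in>{Suc N..}. circle_arc (\<omega> k) (L k))"
    unfolding AE_all_countable by simp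
  then show ?thesis
  proof eventually_elim
    case (elim \<omega>)
    \<comment> \<open>Coordinates are indexed from 1 while \<open>limsup\<close> takes tails from 0,
      so each tail is bounded below by the next one.\<close>
    have "(\<Union>k\<in>{Suc N..}. circle_arc (\<omega> k) (L k)) \<subseteq> (\<Union>k\<in>{N..}. circle_arc (\<omega> k) (L k))" for N
      by (intro UN_mono) auto
    with elim show ?case unfolding limsup_INF_SUP by (meson INT_greatest order_trans)
  qed
qed

text \<open>Since \<open>m < c\<close>, the number \<open>1 / c\<close> lies strictly below the
  assumed bound on the limsup, and \<open>q\<close> is chosen in between. This supplies the rate
  condition of the covering lemma for any \<open>c\<close> above the minimum.\<close>

lemma frequently_ge_mult_ln:
  fixes S :: "nat \<Rightarrow> real"
  assumes lim: "limsup (\<lambda>n. ereal (S n / ln (real n))) \<ge> (if m = 0 then \<infinity> else ereal (1 / m))"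
    and m: "0 \<le> m" "m < c"
  shows "\<exists>q. 1 < c * q \<and> (\<exists>\<^sub>F n in sequentially. q * ln (real n) \<le> S n)"
proof -
  obtain q where q: "1 / c < q" "ereal q < (if m = 0 then \<infinity> else ereal (1 / m))"
  proof (cases "m = 0")
    case True
    show ?thesis using that[of "1 / c + 1"] True by simp
  next
    case False
    then have "1 / c < 1 / m" using m by (simp add: frac_less2)
    then show ?thesis using that dense False by auto
  qed
  have "\<exists>\<^sub>F n in sequentially. ereal q < ereal (S n / ln (real n))"
  proof (rule ccontr)
    assume "\<not> ?thesis"
    then have "\<forall>\<^sub>F n in sequentially. ereal (S n / ln (real n)) \<le> ereal q"
      by (simp add: not_frequently not_less)
    then have "limsup (\<lambda>n. ereal (S n / ln (real n))) \<le> ereal q" by (rule Limsup_bounded)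
    with lim q(2) show False by (meson leD order_trans)
  qed
  \<comment> \<open>From \<open>n = 2\<close> on the logarithm is positive and the division can be
    cleared.\<close>
  then have "\<exists>\<^sub>F n in sequentially. 2 \<le> n \<and> ereal q < ereal (S n / ln (real n))"
    by (intro frequently_eventually_conj eventually_ge_at_top)
  then have "\<exists>\<^sub>F n in sequentially. q * ln (real n) \<le> S n"
    by (rule frequently_elim1) (auto simp: pos_less_divide_eq)
  moreover have "1 < c * q" using q(1) m by (simp add: pos_divide_less_eq mult.commute)
  ultimately show ?thesis by blast
qed

text \<open>Off the minimal set the radius and the gap above \<open>min_val g\<close> vary with the
  point, whereas the covering lemma needs uniform ones. The countably many sets \<open>F j\<close>,
  with radius and gap \<open>e j\<close>, exhaust the complement.\<close>

lemma AE_complement_min_set_subset_limsup_arcs: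
  assumes g: "circle_pdf g" and anti: "antimono_on {1..} L" and pos: "\<And>n. 1 \<le> n \<Longrightarrow> 0 < L n"
    and lim: "limsup (\<lambda>n. ereal ((\<Sum>k=1..n. L k) / ln (real n)))
      \<ge> (if min_val g = 0 then \<infinity> else ereal (1 / min_val g))"
  shows "AE \<omega> in (\<Pi>\<^sub>M n\<in>{1..}. law g). circle - min_set g \<subseteq> limsup (\<lambda>n. circle_arc (\<omega> n) (L n))"
proof -
  have nn: "0 \<le> g x" if "x \<in> circle" for x using g that by (simp add: circle_pdf_def)
  have m: "0 \<le> min_val g" using nn by (rule min_val_nonneg)
  define e where "e j = 1 / real (Suc j)" for j
  have e: "0 < e j" for j by (simp add: e_def)
  define F where "F j = {x \<in> circle. AE y in circle_measure. y \<in> circle_ball x (e j) \<longrightarrow> min_val g + e j \<le> g y}" for j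
  have "AE \<omega> in (\<Pi>\<^sub>M n\<in>{1..}. law g). F j \<subseteq> limsup (\<lambda>n. circle_arc (\<omega> n) (L n))" for j
  proof -
    obtain q where q: "1 < (min_val g + e j) * q" "\<exists>\<^sub>F n in sequentially. q * ln (real n) \<le> (\<Sum>k=1..n. L k)"
      using frequently_ge_mult_ln[OF lim m, of "min_val g + e j"] e[of j] by auto
    show ?thesis
    proof (rule AE_subset_limsup_arcs[OF g anti pos _ q])
      show "0 < min_val g + e j" using m e[of j] by simp
      show "F j \<subseteq> circle" by (auto simp: F_def)
      show "0 < min (e j) (1/2)" using e[of j] by simp
      fix x r assume x: "x \<in> F j" and r: "0 < r" "r \<le> min (e j) (1/2)"
      have "circle_ball x r \<subseteq> circle_ball x (e j)" using r by (intro circle_ball_mono) simp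
      then have "AE y in circle_measure. y \<in> circle_ball x r \<longrightarrow> min_val g + e j + indicator {} y \<le> g y"
        using x by (auto simp: F_def elim!: eventually_mono)
      then have "(min_val g + e j) * measure circle_measure (circle_ball x r) + measure circle_measure {}
          \<le> measure (law g) (circle_ball x r)"
        by (intro measure_law_ge g circle_ball_borel circle_ball_subset) auto
      moreover have "(min_val g + e j) * (2 * r) \<le> (min_val g + e j) * measure circle_measure (circle_ball x r)"
        using x r m e[of j] by (intro mult_left_mono measure_circle_ball_ge) (auto simp: F_def)
      ultimately show "2 * (min_val g + e j) * r \<le> measure (law g) (circle_ball x r)"
        by (simp add: mult_ac)
    qed
  qed
  then have "AE \<omega> in (\<Pi>\<^sub>M n\<in>{1..}. law g). \<forall>j. F j \<subseteq> limsup (\<lambda>n. circle_arc (\<omega> n) (L n))"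
    unfolding AE_all_countable by blast
  moreover have "circle - min_set g \<subseteq> (\<Union>j. F j)"
  proof
    fix x assume x: "x \<in> circle - min_set g"
    then obtain r a where r: "r > 0" and a: "a > min_val g"
      and ae: "AE y in circle_measure. y \<in> circle_ball x r \<longrightarrow> a \<le> g y"
      using not_in_min_set_iff[of g x] nn by blast
    obtain j where j: "e j < min r (a - min_val g)"
      using nat_approx_posE[of "min r (a - min_val g)"] r a unfolding e_def by auto
    then have "circle_ball x (e j) \<subseteq> circle_ball x r" by (intro circle_ball_mono) simp
    then have "AE y in circle_measure. y \<in> circle_ball x (e j) \<longrightarrow> min_val g + e j \<le> g y"
      using ae j by (auto elim!: eventually_mono)
    then have "x \<in> F j" using x by (simp add: F_def)
    then show "x \<in> (\<Union>j. F j)" by blast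
  qed
  ultimately show ?thesis by (auto elim!: eventually_mono)
qed

section \<open>Modifying the density near the minimal set\<close>

text \<open>
  The circle distance to \<open>K\<close> is written as the distance on the real line to the periodic set lifted from
  \<open>K\<close>, which makes its continuity available.
\<close>

lemma infdist_lift_less_iff:
  assumes "K \<subseteq> circle" "K \<noteq> {}"
  shows "infdist y {x. frac x \<in> K} < r \<longleftrightarrow> (\<exists>x\<in>K. circle_dist x y < r)"
proof
  have ne: "{x. frac x \<in> K} \<noteq> {}"
  proof -
    obtain x where "x \<in> K" using assms by blast
    then have "frac x \<in> K" using assms(1) by (auto simp: circle_def frac_eq)
    then show ?thesis by blast
  qed
  assume "infdist y {x. frac x \<in> K} < r"
  then have "(INF a\<in>{x. frac x \<in> K}. dist y a) < r" by (simp add: infdist_notempty[OF ne])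
  then obtain a where a: "frac a \<in> K" "dist y a < r"
    by (subst (asm) cINF_less_iff) (use ne in \<open>auto intro!: bdd_belowI[of _ 0]\<close>)
  have "\<bar>frac a - y - of_int (- \<lfloor>a\<rfloor>)\<bar> < r" using a(2) by (simp add: frac_def dist_real_def)
  then have "circle_dist (frac a) y < r" unfolding circle_dist_less_iff by blast
  with a(1) show "\<exists>x\<in>K. circle_dist x y < r" by blast
next
  assume "\<exists>x\<in>K. circle_dist x y < r"
  then obtain x n where x: "x \<in> K" and n: "\<bar>x - y - of_int n\<bar> < r"
    unfolding circle_dist_less_iff by blast
  have "frac (x - of_int n) = frac x" by (simp add: frac_def)
  also have "frac x = x" using x assms(1) by (auto simp: circle_def frac_eq)
  finally have "infdist y {x. frac x \<in> K} \<le> dist y (x - of_int n)" using x by (intro infdist_le) simp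
  also have "\<dots> < r" using n by (simp add: dist_real_def)
  finally show "infdist y {x. frac x \<in> K} < r" .
qed

text \<open>If \<open>g\<close> is at least \<open>a > min_val g\<close> on the ball of radius
  \<open>r\<close> around \<open>y\<close>, the same bound holds on a half-size ball around each
  point within \<open>r / 2\<close>, so no such point is minimal. Nonemptiness matters because
  \<open>infdist\<close> to the empty set is 0.\<close>

lemma infdist_lift_min_set_pos:
  assumes nn: "\<And>x. x \<in> circle \<Longrightarrow> 0 \<le> g x"
    and y: "y \<in> circle - min_set g" and ne: "min_set g \<noteq> {}"
  shows "0 < infdist y {x. frac x \<in> min_set g}"
proof -
  have K: "min_set g \<subseteq> circle" by (auto simp: min_set_def)
  obtain r a where r: "r > 0" and a: "a > min_val g"
    and ae: "AE z in circle_measure. z \<in> circle_ball y r \<longrightarrow> a \<le> g z"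
    using not_in_min_set_iff[of g y] nn y by blast
  have "\<not> infdist y {x. frac x \<in> min_set g} < r / 2"
  proof
    assume "infdist y {x. frac x \<in> min_set g} < r / 2"
    then obtain x where x: "x \<in> min_set g" "circle_dist x y < r / 2"
      using infdist_lift_less_iff[OF K ne] by blast
    have "circle_ball x (r / 2) \<subseteq> circle_ball y r"
      using circle_dist_triangle_less[of y x "r / 2" _ "r / 2"] x(2)
      by (auto simp: circle_ball_def circle_dist_commute)
    then have "AE z in circle_measure. z \<in> circle_ball x (r / 2) \<longrightarrow> a \<le> g z"
      using ae by (auto elim!: eventually_mono)
    moreover have "0 < r / 2" using r by simp
    ultimately show False using not_in_min_set_iff[of g x] nn x(1) K a by blast
  qed
  then show ?thesis using r by linarith
qed

text \<open>
  \<open>Z\<close> is a union of intervals around the rationals \<open>q j\<close>. As their radii are at most \<open>d (q j)\<close> times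
  \<open>1 / 2^(j + 3)\<close>, an interval meeting a ball of radius \<open>r\<close> centred in \<open>K\<close> has length at most
  \<open>r / 2^(j + 1)\<close>.
\<close>

lemma sparse_set_exists:
  assumes K: "K \<subseteq> circle"
  defines "d \<equiv> \<lambda>y. infdist y {x. frac x \<in> K}"
  obtains Z :: "real set" where "open Z"
    "\<And>x r. x \<in> K \<Longrightarrow> 0 < r \<Longrightarrow> measure circle_measure (Z \<inter> circle_ball x r) \<le> r"
    "\<And>a b y. {a<..<b} \<subseteq> circle \<Longrightarrow> y \<in> {a<..<b} \<Longrightarrow> 0 < d y \<Longrightarrow> Z \<inter> {a<..<b} \<notin> null_sets circle_measure"
proof -
  define q where "q = from_nat_into (\<rat> :: real set)"
  have range_q: "range q = \<rat>"
    unfolding q_def by (rule range_from_nat_into) (use Rats_0 in blast, rule countable_rat)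
  define \<rho> where "\<rho> j = (1/2) ^ j * d (q j) / 8" for j
  define I where "I j = {q j - \<rho> j<..<q j + \<rho> j}" for j
  have d0: "0 \<le> d y" for y by (simp add: d_def infdist_nonneg)
  have d_cont: "open {y. 0 < d y}"
    unfolding d_def by (intro open_Collect_less continuous_intros)
  show ?thesis
  proof (rule that[of "\<Union>j. I j"])
    show "open (\<Union>j. I j)" by (auto simp: I_def)
  next
    fix x r :: real assume x: "x \<in> K" and r: "0 < r"
    \<comment> \<open>\<open>J\<close> retains only the intervals short enough to be able to meet
      the ball.\<close>
    define J where "J j = (if \<rho> j \<le> (1/2) ^ j * (r / 4) then I j else {})" for j
    have "(\<Union>j. I j) \<inter> circle_ball x r \<subseteq> (\<Union>j. J j)"
    proof
      fix y assume y: "y \<in> (\<Union>j. I j) \<inter> circle_ball x r"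
      then obtain j where j: "y \<in> I j" by blast
      have "d y < r" using infdist_lift_less_iff[OF K] x y unfolding d_def by (auto simp: circle_ball_def)
      have "(1/2) ^ j \<le> (1::real)" by (simp add: power_le_one)
      then have "\<rho> j \<le> d (q j) / 8" using d0[of "q j"] by (simp add: \<rho>_def mult_left_le_one_le)
      moreover have "d (q j) \<le> d y + \<rho> j"
        using infdist_triangle[of "q j" _ y] j unfolding d_def I_def
        by (smt (verit) dist_real_def greaterThanLessThan_iff)
      \<comment> \<open>A radius of at most \<open>d (q j) / 8\<close> forces \<open>d (q j)\<close>
        to be at most \<open>8/7\<close> of \<open>d y\<close>; the factor 2 is a convenient
        weakening. The lengths of the retained intervals then sum to at most
        \<open>r\<close>.\<close>
      ultimately have "d (q j) \<le> 2 * r" using \<open>d y < r\<close> r by linarith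
      then have "\<rho> j \<le> (1/2) ^ j * (r / 4)" by (simp add: \<rho>_def)
      then show "y \<in> (\<Union>j. J j)" using j by (auto simp: J_def)
    qed
    then have "emeasure lborel ((\<Union>j. I j) \<inter> circle_ball x r) \<le> emeasure lborel (\<Union>j. J j)"
      by (intro emeasure_mono) (auto simp: J_def I_def)
    also have "\<dots> \<le> (\<Sum>j. emeasure lborel (J j))"
      by (intro emeasure_subadditive_countably) (auto simp: J_def I_def)
    also have "\<dots> \<le> (\<Sum>j. ennreal ((1/2) ^ j * (r / 2)))"
    proof (intro suminf_le)
      fix j
      have "0 \<le> \<rho> j" using d0[of "q j"] by (simp add: \<rho>_def)
      then show "emeasure lborel (J j) \<le> ennreal ((1/2) ^ j * (r / 2))"
        by (auto simp: J_def I_def intro!: ennreal_leI)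
    qed auto
    also have "\<dots> = ennreal r"
    proof (rule suminf_ennreal_eq)
      show "(\<lambda>j. (1/2) ^ j * (r / 2)) sums r"
        using geometric_sums[of "1/2::real", THEN sums_mult2, of "r / 2"] by simp
    qed (use r in simp)
    finally have "emeasure lborel ((\<Union>j. I j) \<inter> circle_ball x r) \<le> ennreal r" .
    moreover have "emeasure circle_measure ((\<Union>j. I j) \<inter> circle_ball x r) = emeasure lborel ((\<Union>j. I j) \<inter> circle_ball x r)"
      using circle_ball_subset by (intro emeasure_circle_measure) (auto simp: I_def)
    ultimately show "measure circle_measure ((\<Union>j. I j) \<inter> circle_ball x r) \<le> r"
      using r by (simp add: measure_def enn2real_leI)
  next
    fix a b y :: real assume ab: "{a<..<b} \<subseteq> circle" and y: "y \<in> {a<..<b}" "0 < d y"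
    \<comment> \<open>Positivity of \<open>d\<close> is an open condition, so some rational near
      \<open>y\<close> has \<open>d > 0\<close> and hence a nondegenerate interval in
      \<open>Z\<close>.\<close>
    have "open ({y. 0 < d y} \<inter> {a<..<b})" "y \<in> {y. 0 < d y} \<inter> {a<..<b}" using d_cont y by auto
    then obtain e where e: "0 < e" "ball y e \<subseteq> {y. 0 < d y} \<inter> {a<..<b}"
      by (rule openE)
    obtain z where "z \<in> \<rat>" "y < z" "z < y + e"
      using Rats_dense_in_real[of y "y + e"] e(1) by auto
    moreover from this have "z \<in> ball y e" by (simp add: dist_real_def)
    ultimately have z: "z \<in> \<rat>" "z \<in> {y. 0 < d y} \<inter> {a<..<b}" using e(2) by blast+
    from z(1) obtain j where j: "z = q j" using range_q by blast
    have "0 < \<rho> j" using z j by (simp add: \<rho>_def)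
    then have lt: "max a (q j - \<rho> j) < min b (q j + \<rho> j)"
      using z j by auto
    have "emeasure lborel {max a (q j - \<rho> j)<..<min b (q j + \<rho> j)} \<noteq> 0"
      unfolding emeasure_lborel_Ioo[OF less_imp_le[OF lt]] ennreal_eq_0_iff using lt by linarith
    moreover have "emeasure lborel {max a (q j - \<rho> j)<..<min b (q j + \<rho> j)} \<le> emeasure lborel ((\<Union>j. I j) \<inter> {a<..<b})"
      by (intro emeasure_mono) (auto simp: I_def)
    moreover have "emeasure circle_measure ((\<Union>j. I j) \<inter> {a<..<b}) = emeasure lborel ((\<Union>j. I j) \<inter> {a<..<b})"
      using ab by (intro emeasure_circle_measure) (auto simp: I_def)
    ultimately show "(\<Union>j. I j) \<inter> {a<..<b} \<notin> null_sets circle_measure" by auto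
  qed
qed

text \<open>The neighbourhoods \<open>?A n\<close> shrink to a null set, so dominated convergence
  with majorant \<open>norm (h y)\<close> applies.\<close>

lemma small_neighborhood_integral:
  fixes d h :: "real \<Rightarrow> real"
  assumes [measurable]: "d \<in> borel_measurable circle_measure" and h: "integrable circle_measure h"
    and pos: "AE y in circle_measure. 0 < d y" and e: "0 < e"
  obtains u where "0 < u" "u \<le> 1" "(\<integral>y. indicator {y \<in> circle. d y < u} y * h y \<partial>circle_measure) < e"
proof -
  let ?A = "\<lambda>n. {y \<in> circle. d y < 1 / real (Suc n)}"
  have [measurable]: "h \<in> borel_measurable circle_measure" using h by simp
  have A [measurable]: "?A n \<in> sets circle_measure" for n
  proof -
    have "{y \<in> space circle_measure. d y < 1 / real (Suc n)} \<in> sets circle_measure" by measurable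
    then show ?thesis by simp
  qed
  have "(\<lambda>n. \<integral>y. indicator (?A n) y * h y \<partial>circle_measure) \<longlonglongrightarrow> (\<integral>y. 0 \<partial>circle_measure)"
  proof (rule integral_dominated_convergence)
    show "integrable circle_measure (\<lambda>y. norm (h y))" using h by simp
    show "AE y in circle_measure. (\<lambda>n. indicator (?A n) y * h y) \<longlonglongrightarrow> 0"
      using pos
    proof eventually_elim
      case (elim y)
      then obtain n0 where n0: "1 / real (Suc n0) < d y" using nat_approx_posE by blast
      have "indicator (?A n) y * h y = 0" if "n0 \<le> n" for n
      proof -
        have "1 / real (Suc n) \<le> 1 / real (Suc n0)" using that by (intro divide_left_mono) auto
        then have "y \<notin> ?A n" using n0 by simp
        then show ?thesis by simp
      qed
      then show ?case by (intro tendsto_eventually) (auto simp: eventually_sequentially)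
    qed
    show "AE y in circle_measure. norm (indicator (?A n) y * h y) \<le> norm (h y)" for n
      by (intro AE_I2) (auto split: split_indicator)
    show "(\<lambda>y. indicator (?A n) y * h y) \<in> borel_measurable circle_measure" for n
      using A[of n] \<open>h \<in> borel_measurable circle_measure\<close> by (intro borel_measurable_times borel_measurable_indicator)
  qed simp
  then have "\<forall>\<^sub>F n in sequentially. (\<integral>y. indicator (?A n) y * h y \<partial>circle_measure) < e"
    using e by (intro order_tendstoD) auto
  then obtain n where "(\<integral>y. indicator (?A n) y * h y \<partial>circle_measure) < e"
    by (auto simp: eventually_sequentially)
  then show ?thesis by (intro that[of "1 / real (Suc n)"]) auto
qed

text \<open>The rate \<open>min_val f + 1/2\<close> comes from counting: a ball of radius
  \<open>r\<close> has measure at least \<open>2 * r\<close>, of which \<open>Z\<close> takes at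
  most \<open>r\<close>, and outside \<open>Z\<close> the new density exceeds the minimum by
  1.\<close>

lemma density_modification:
  assumes f: "circle_pdf f" and null: "min_set f \<in> null_sets circle_measure"
    and ne: "min_set f \<noteq> {}" and \<epsilon>: "0 < \<epsilon>"
  obtains f\<^sub>0 u where "circle_pdf f\<^sub>0" "min_val f\<^sub>0 = min_val f" "min_set f\<^sub>0 = min_set f"
    "measure circle_measure {x \<in> circle. f x \<noteq> f\<^sub>0 x} \<le> \<epsilon>" "0 < u"
    "\<And>x r. x \<in> min_set f \<Longrightarrow> 0 < r \<Longrightarrow> r \<le> u \<Longrightarrow>
      2 * (min_val f + 1/2) * r \<le> measure (law f\<^sub>0) (circle_ball x r)"
proof -
  interpret finite_measure circle_measure by (rule finite_measure_circle)
  define K where "K = min_set f"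
  define m where "m = min_val f"
  define d where "d = (\<lambda>y. infdist y {x. frac x \<in> K})"
  have nn: "0 \<le> f x" if "x \<in> circle" for x using f that by (simp add: circle_pdf_def)
  have fint: "integrable circle_measure f" and f1: "integral\<^sup>L circle_measure f = 1"
    using f by (auto simp: circle_pdf_def)
  have [measurable]: "f \<in> borel_measurable circle_measure" using fint by simp
  have m0: "0 \<le> m" unfolding m_def using nn by (rule min_val_nonneg)
  have K: "K \<subseteq> circle" by (auto simp: K_def min_set_def)
  have neK: "K \<noteq> {}" using ne by (simp add: K_def)
  have d_iff: "d y < r \<longleftrightarrow> (\<exists>x\<in>K. circle_dist x y < r)" for y r
    unfolding d_def by (rule infdist_lift_less_iff[OF K neK])
  have d0: "0 \<le> d y" for y by (simp add: d_def infdist_nonneg)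
  have dpos: "0 < d y" if "y \<in> circle" "y \<notin> K" for y
    using infdist_lift_min_set_pos[of f y] nn that ne unfolding d_def K_def by blast
  have d_meas [measurable]: "d \<in> borel_measurable circle_measure"
    unfolding d_def by (intro borel_measurable_circle borel_measurable_continuous_onI continuous_intros)
  have AEc: "AE y in circle_measure. y \<in> circle" using AE_space[of circle_measure] by simp
  have AEpos: "AE y in circle_measure. 0 < d y"
    using AE_not_in[OF null] AEc by eventually_elim (auto simp: K_def intro: dpos)
  have AEm: "AE y in circle_measure. m \<le> f y" unfolding m_def using nn by (rule AE_min_val_le)

  \<comment> \<open>This interval is reserved for the mass correction: \<open>f\<close> exceeds the
    minimum there by a margin. It exists because a null \<open>K\<close> cannot be the whole
    circle.\<close>
  obtain p h \<eta> where h: "0 < h" "h \<le> \<epsilon> / 2" and pc: "{p<..<p + h} \<subseteq> circle" and \<eta>: "0 < \<eta>"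
    and AEp: "AE y in circle_measure. y \<in> {p<..<p + h} \<longrightarrow> m + 2 * \<eta> \<le> f y"
  proof -
    have "K \<noteq> circle" using null circle_not_null unfolding K_def by metis
    then obtain x where x: "x \<in> circle" "x \<notin> K" using K by blast
    then obtain r a where r: "r > 0" and a: "a > m"
      and ae: "AE y in circle_measure. y \<in> circle_ball x r \<longrightarrow> a \<le> f y"
      using not_in_min_set_iff[of f x] nn unfolding K_def m_def by blast
    obtain b c where bc: "b < c" "{b<..<c} \<subseteq> circle_ball x r"
      using interval_in_circle_ball[OF x(1) r] .
    define h where "h = min (c - b) (\<epsilon> / 2)"
    have "b + h \<le> c" by (simp add: h_def min_def)
    then have "{b<..<b + h} \<subseteq> {b<..<c}" by auto
    then have sub: "{b<..<b + h} \<subseteq> circle_ball x r" using bc(2) by (rule order_trans)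
    show ?thesis
    proof (rule that[of h b "(a - m) / 2"])
      show "{b<..<b + h} \<subseteq> circle" using sub circle_ball_subset by blast
      show "AE y in circle_measure. y \<in> {b<..<b + h} \<longrightarrow> m + 2 * ((a - m) / 2) \<le> f y"
        using ae
      proof (rule eventually_mono)
        fix y assume "y \<in> circle_ball x r \<longrightarrow> a \<le> f y"
        moreover have "m + 2 * ((a - m) / 2) = a" by (simp add: field_simps)
        ultimately show "y \<in> {b<..<b + h} \<longrightarrow> m + 2 * ((a - m) / 2) \<le> f y" using sub by auto
      qed
    qed (use bc \<epsilon> a in \<open>auto simp: h_def min_def\<close>)
  qed
  \<comment> \<open>Removing the exceptional null set makes the lower bound hold at every point of
    \<open>A\<close>, as the pointwise nonnegativity in \<open>circle_pdf\<close> demands.\<close>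
  define A where "A = {y \<in> {p<..<p + h}. m + 2 * \<eta> \<le> f y}"
  have Ip [measurable]: "{p<..<p + h} \<in> sets circle_measure" using pc by (intro sets_circle_measureI) auto
  have A_sets [measurable]: "A \<in> sets circle_measure"
  proof -
    have "{y \<in> space circle_measure. m + 2 * \<eta> \<le> f y} \<in> sets circle_measure" by measurable
    moreover have "A = {p<..<p + h} \<inter> {y \<in> space circle_measure. m + 2 * \<eta> \<le> f y}"
      using pc by (auto simp: A_def)
    ultimately show ?thesis by simp
  qed
  have A_measure: "measure circle_measure A = h"
  proof -
    have "measure circle_measure A = measure circle_measure {p<..<p + h}"
      using AEp by (intro finite_measure_eq_AE A_sets Ip) (auto simp: A_def elim!: eventually_mono)
    also have "\<dots> = h" using h pc by (simp add: measure_def emeasure_circle_measure)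
    finally show ?thesis .
  qed

  obtain Z where Z: "open Z"
    "\<And>x r. x \<in> K \<Longrightarrow> 0 < r \<Longrightarrow> measure circle_measure (Z \<inter> circle_ball x r) \<le> r"
    "\<And>a b y. {a<..<b} \<subseteq> circle \<Longrightarrow> y \<in> {a<..<b} \<Longrightarrow> 0 < d y \<Longrightarrow> Z \<inter> {a<..<b} \<notin> null_sets circle_measure"
    unfolding d_def using sparse_set_exists[OF K] by blast
  define H where "H y = m + (if y \<in> Z then d y else 1)" for y
  have ZB: "Z \<inter> B \<in> sets circle_measure" if "B \<in> sets borel" "B \<subseteq> circle" for B
    using that Z(1) by (intro sets_circle_measureI) auto
  have H_meas [measurable]: "H \<in> borel_measurable circle_measure"
  proof -
    have "(\<lambda>y. infdist y {x. frac x \<in> K}) \<in> borel_measurable borel"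
      by (intro borel_measurable_continuous_onI continuous_intros)
    moreover have "Z \<in> sets borel" using Z(1) by simp
    ultimately have "H \<in> borel_measurable borel" unfolding H_def d_def by measurable
    then show ?thesis by (rule borel_measurable_circle)
  qed

  \<comment> \<open>The three bounds keep the altered set within \<open>\<epsilon>\<close>, leave at
    least half of \<open>A\<close> outside \<open>U\<close>, and ensure
    \<open>\<bar>t\<bar> \<le> \<eta>\<close>.\<close>
  define \<kappa> where "\<kappa> = min (\<epsilon> / 2) (min (h / 2) (\<eta> * h / 2))"
  have \<kappa>: "0 < \<kappa>" using \<epsilon> h \<eta> by (simp add: \<kappa>_def)
  \<comment> \<open>On \<open>U\<close> this function dominates both
    \<open>\<bar>f y - H y\<bar>\<close> and 1, so one small integral controls the change of mass
    and the measure of \<open>U\<close> together.\<close>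
  have g_int: "integrable circle_measure (\<lambda>y. f y + (m + 1))" using fint by simp
  obtain u where u: "0 < u" "u \<le> 1"
    and u_int: "(\<integral>y. indicator {y \<in> circle. d y < u} y * (f y + (m + 1)) \<partial>circle_measure) < \<kappa>"
    using small_neighborhood_integral[OF d_meas g_int AEpos \<kappa>] .
  define U where "U = {y \<in> circle. d y < u}"
  have U_sets [measurable]: "U \<in> sets circle_measure"
  proof -
    have "{y \<in> space circle_measure. d y < u} \<in> sets circle_measure" by measurable
    then show ?thesis by (simp add: U_def)
  qed
  have H_U: "m \<le> H y" "H y \<le> m + 1" if "y \<in> U" for y
    using that u d0[of y] by (auto simp: H_def U_def)
  have gU_int: "integrable circle_measure (\<lambda>y. indicator U y * (f y + (m + 1)))"
    using integrable_mult_indicator[OF U_sets g_int] by simp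
  have dom: "\<bar>indicator U y * (f y - H y)\<bar> \<le> indicator U y * (f y + (m + 1))" if "y \<in> circle" for y
  proof (cases "y \<in> U")
    case True
    then show ?thesis using nn[OF that] H_U[OF True] m0 by (auto simp: abs_le_iff)
  qed simp
  have dU_int: "integrable circle_measure (\<lambda>y. indicator U y * (f y - H y))"
  proof (rule Bochner_Integration.integrable_bound[OF gU_int])
    show "AE y in circle_measure. norm (indicator U y * (f y - H y)) \<le> norm (indicator U y * (f y + (m + 1)))"
      using AEc by eventually_elim (use dom in force)
  qed measurable
  define s where "s = (\<integral>y. indicator U y * (f y - H y) \<partial>circle_measure)"
  have s_bound: "\<bar>s\<bar> < \<kappa>"
  proof -
    have "\<bar>s\<bar> \<le> (\<integral>y. \<bar>indicator U y * (f y - H y)\<bar> \<partial>circle_measure)"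
      unfolding s_def by (rule integral_abs_bound)
    also have "\<dots> \<le> (\<integral>y. indicator U y * (f y + (m + 1)) \<partial>circle_measure)"
      using AEc by (intro integral_mono_AE integrable_abs dU_int gU_int) (auto elim!: eventually_mono intro: dom)
    also have "\<dots> < \<kappa>" using u_int by (simp add: U_def)
    finally show ?thesis .
  qed
  have U_measure: "measure circle_measure U < \<kappa>"
  proof -
    have "measure circle_measure U = (\<integral>y. indicator U y \<partial>circle_measure)"
      using sets.sets_into_space[OF U_sets] by (simp add: Int_absorb2)
    also have "\<dots> \<le> (\<integral>y. indicator U y * (f y + (m + 1)) \<partial>circle_measure)"
    proof (rule integral_mono_AE)
      show "AE y in circle_measure. indicator U y \<le> indicator U y * (f y + (m + 1))"
        using AEc by eventually_elim (use nn m0 in \<open>auto split: split_indicator\<close>)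
    qed (use gU_int in \<open>simp_all add: emeasure_eq_measure\<close>)
    also have "\<dots> < \<kappa>" using u_int by (simp add: U_def)
    finally show ?thesis .
  qed
  define a where "a = measure circle_measure (A - U)"
  have a: "h / 2 \<le> a"
  proof -
    have "measure circle_measure A \<le> measure circle_measure ((A - U) \<union> U)"
      by (intro finite_measure_mono) auto
    also have "\<dots> \<le> a + measure circle_measure U"
      unfolding a_def by (intro measure_Un_le) auto
    finally show ?thesis using U_measure A_measure by (simp add: \<kappa>_def)
  qed
  \<comment> \<open>Replacing \<open>f\<close> by \<open>H\<close> on \<open>U\<close> removes the
    mass \<open>s\<close>; adding \<open>t\<close> on \<open>A - U\<close>, of measure
    \<open>a\<close>, restores it.\<close>
  define t where "t = s / a"
  have t: "\<bar>t\<bar> \<le> \<eta>"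
  proof -
    have "\<bar>s\<bar> \<le> \<eta> * (h / 2)" using s_bound by (simp add: \<kappa>_def)
    also have "\<dots> \<le> \<eta> * a" using a \<eta> by (intro mult_left_mono) auto
    finally show ?thesis using a h by (simp add: t_def abs_divide pos_divide_le_eq)
  qed
  define f0 where "f0 y = (if y \<in> U then H y else if y \<in> A then f y + t else f y)" for y
  have f0_eq: "f0 y = f y - indicator U y * (f y - H y) + t * indicator (A - U) y" for y
    by (auto simp: f0_def split: split_indicator)
  have f0_A: "m + \<eta> \<le> f0 y" if "y \<in> A" "y \<notin> U" for y
    using that t by (auto simp: f0_def A_def)
  have tA_int: "integrable circle_measure (\<lambda>y. t * indicator (A - U) y)"
    by (auto simp: emeasure_eq_measure)
  have f0_pdf: "circle_pdf f0"
    unfolding circle_pdf_def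
  proof (intro conjI ballI)
    fix x assume x: "x \<in> circle"
    show "0 \<le> f0 x"
      using f0_A[of x] H_U[of x] nn[OF x] m0 \<eta> by (auto simp: f0_def split: if_splits)
  next
    show "integrable circle_measure f0"
      unfolding f0_eq using fint dU_int tA_int by (intro Bochner_Integration.integrable_add Bochner_Integration.integrable_diff)
    have "integral\<^sup>L circle_measure f0 = 1 - s + t * a"
    proof -
      have "(A - U) \<inter> circle = A - U" using sets.sets_into_space[OF A_sets] by auto
      then have "(\<integral>y. t * indicator (A - U) y \<partial>circle_measure) = t * a" by (simp add: a_def)
      then show ?thesis unfolding f0_eq using fint dU_int tA_int by (simp add: f1 s_def)
    qed
    then show "integral\<^sup>L circle_measure f0 = 1" using a h by (simp add: t_def)
  qed
  then have nn0: "0 \<le> f0 x" if "x \<in> circle" for x using that by (simp add: circle_pdf_def)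
  have ball_U: "y \<in> U" "d y < r" if "x \<in> K" "y \<in> circle_ball x r" "r \<le> u" for x y r
  proof -
    show "d y < r" unfolding d_iff using that by (auto simp: circle_ball_def)
    then show "y \<in> U" using that by (auto simp: U_def circle_ball_def)
  qed
  \<comment> \<open>Near \<open>x\<close>, points of \<open>Z\<close> have
    \<open>f0 y = m + d y < b\<close>. They form a non-null set, because a null \<open>K\<close>
    cannot contain an interval and \<open>Z\<close> charges any interval holding a point with
    \<open>d > 0\<close>.\<close>
  have upper: "b \<le> m"
    if x: "x \<in> K" and r: "0 < r" and ae: "AE y in circle_measure. y \<in> circle_ball x r \<longrightarrow> b \<le> f0 y" for x r b
  proof (rule ccontr)
    assume b: "\<not> b \<le> m"
    define r' where "r' = min (min r u) (b - m)"
    have r': "0 < r'" "r' \<le> u" using r u b by (auto simp: r'_def)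
    obtain v w where vw: "v < w" "{v<..<w} \<subseteq> circle_ball x r'"
      using interval_in_circle_ball[of x r'] x K r' by blast
    have vw_c: "{v<..<w} \<subseteq> circle" using vw(2) circle_ball_subset by blast
    have Zm: "Z \<inter> {v<..<w} \<in> sets circle_measure" using vw_c by (intro ZB) auto
    have "AE y in circle_measure. y \<notin> Z \<inter> {v<..<w}"
      using ae
    proof eventually_elim
      case (elim y)
      show ?case
      proof
        assume y: "y \<in> Z \<inter> {v<..<w}"
        then have yb: "y \<in> circle_ball x r'" using vw by blast
        moreover have "circle_ball x r' \<subseteq> circle_ball x r" by (rule circle_ball_mono) (simp add: r'_def)
        ultimately have "b \<le> f0 y" using elim by blast
        moreover have "f0 y = m + d y" using ball_U(1)[OF x yb r'(2)] y by (simp add: f0_def H_def)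
        moreover have "d y < b - m" using ball_U(2)[OF x yb r'(2)] by (simp add: r'_def)
        ultimately show False by simp
      qed
    qed
    then have Znull: "Z \<inter> {v<..<w} \<in> null_sets circle_measure" using Zm by (simp add: AE_iff_null_sets)
    have "\<not> {v<..<w} \<subseteq> K"
    proof
      assume "{v<..<w} \<subseteq> K"
      then have "{v<..<w} \<in> null_sets circle_measure"
        using null vw_c by (intro null_sets_subset[OF null] sets_circle_measureI) (auto simp: K_def)
      then have "emeasure lborel {v<..<w} = 0"
        using emeasure_circle_measure[of "{v<..<w}"] vw_c by (simp add: null_sets_def)
      then show False
        unfolding emeasure_lborel_Ioo[OF less_imp_le[OF vw(1)]] ennreal_eq_0_iff using vw(1) by linarith
    qed
    then obtain y where "y \<in> {v<..<w}" "y \<notin> K" by blast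
    then show False using Z(3)[OF vw_c, of y] dpos[of y] vw_c Znull by blast
  qed
  have AEm0: "AE y in circle_measure. m \<le> f0 y"
    using AEm AEc
  proof eventually_elim
    case (elim y)
    then show ?case using f0_A[of y] H_U[of y] \<eta> by (auto simp: f0_def split: if_splits)
  qed
  have val: "min_val f0 = m"
  proof (rule antisym)
    show "m \<le> min_val f0"
      unfolding min_val_def using AEm0 sets.top[of circle_measure]
      by (intro le_ess_inf circle_not_null) (auto elim!: eventually_mono)
    obtain x where x: "x \<in> K" using neK by blast
    show "min_val f0 \<le> m"
      unfolding min_val_def
    proof (rule ess_inf_le[of f0, OF nn0])
      fix b assume "AE y in circle_measure. y \<in> circle \<longrightarrow> b \<le> f0 y"
      then have "AE y in circle_measure. y \<in> circle_ball x 1 \<longrightarrow> b \<le> f0 y"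
        by (rule eventually_mono) (use circle_ball_subset in blast)
      then show "b \<le> m" using upper[OF x, of 1] by simp
    qed
  qed
  have set: "min_set f0 = K"
  proof (rule antisym)
    show "K \<subseteq> min_set f0"
    proof
      fix x assume x: "x \<in> K"
      show "x \<in> min_set f0"
        using not_in_min_set_iff[of f0 x] nn0 upper[OF x] x K unfolding val by (meson not_less subsetD)
    qed
    show "min_set f0 \<subseteq> K"
    proof
      fix x assume x0: "x \<in> min_set f0"
      show "x \<in> K"
      proof (rule ccontr)
        assume x: "x \<notin> K"
        have xc: "x \<in> circle" using x0 by (simp add: min_set_def)
        obtain r b where r: "r > 0" and b: "b > m"
          and ae: "AE y in circle_measure. y \<in> circle_ball x r \<longrightarrow> b \<le> f y"
          using not_in_min_set_iff[of f x] nn x xc unfolding K_def m_def by blast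
        have dx: "0 < d x" using dpos xc x by blast
        \<comment> \<open>On the ball of radius \<open>r'\<close> the function \<open>d\<close>
          stays at least \<open>d x / 2\<close>. The four terms of \<open>b'\<close> bound
          \<open>f0\<close> where it equals \<open>f\<close>, on \<open>A - U\<close>, on
          \<open>U - Z\<close> and on \<open>U \<inter> Z\<close>.\<close>
        define r' where "r' = min r (d x / 2)"
        define b' where "b' = min (min b (m + \<eta>)) (min (m + 1) (m + d x / 2))"
        have "AE y in circle_measure. y \<in> circle_ball x r' \<longrightarrow> b' \<le> f0 y"
          using ae
        proof eventually_elim
          case (elim y)
          show ?case
          proof
            assume y: "y \<in> circle_ball x r'"
            have "circle_ball x r' \<subseteq> circle_ball x r" by (rule circle_ball_mono) (simp add: r'_def)
            then have fy: "b \<le> f y" using elim y by blast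
            have "\<not> d y < d x / 2"
            proof
              assume "d y < d x / 2"
              then obtain z where z: "z \<in> K" "circle_dist z y < d x / 2" unfolding d_iff by blast
              moreover have "circle_dist y x < d x / 2"
                using y by (simp add: circle_ball_def circle_dist_commute r'_def)
              ultimately have "circle_dist z x < d x / 2 + d x / 2" by (intro circle_dist_triangle_less)
              then have "d x < d x" using z(1) unfolding d_iff[of x "d x"] by auto
              then show False by simp
            qed
            then show "b' \<le> f0 y"
              using f0_A[of y] fy by (auto simp: f0_def H_def b'_def min_le_iff_disj)
          qed
        qed
        moreover have "0 < r'" "m < b'" using r b dx \<eta> by (auto simp: r'_def b'_def)
        ultimately show False using not_in_min_set_iff[of f0 x] nn0 xc x0 unfolding val by blast
      qed
    qed
  qed
  have small: "measure circle_measure {x \<in> circle. f x \<noteq> f0 x} \<le> \<epsilon>"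
  proof -
    have "measure circle_measure {x \<in> circle. f x \<noteq> f0 x} \<le> measure circle_measure (U \<union> A)"
      by (intro finite_measure_mono) (auto simp: f0_def)
    also have "\<dots> \<le> measure circle_measure U + measure circle_measure A"
      by (intro measure_Un_le) auto
    also have "\<dots> \<le> \<epsilon>" using U_measure A_measure h by (simp add: \<kappa>_def)
    finally show ?thesis .
  qed
  \<comment> \<open>The ball lies in \<open>U\<close>, where \<open>f0\<close> is \<open>H\<close>.
    The cap \<open>1/2\<close> on the radius is the one needed for the lower bound on the measure of
    the ball.\<close>
  have mass: "2 * (m + 1/2) * r \<le> measure (law f0) (circle_ball x r)"
    if x: "x \<in> K" and r: "0 < r" "r \<le> min u (1/2)" for x r
  proof -
    let ?B = "circle_ball x r"
    have Bc: "?B \<in> sets circle_measure" and ZBc: "Z \<inter> ?B \<in> sets circle_measure"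
      by (simp_all add: ZB circle_ball_borel circle_ball_subset)
    have "AE y in circle_measure. y \<in> ?B \<longrightarrow> m + indicator (?B - Z \<inter> ?B) y \<le> f0 y"
    proof (rule AE_I2, rule impI)
      fix y assume y: "y \<in> ?B"
      then have "y \<in> U" using ball_U(1)[OF x y] r by simp
      then show "m + indicator (?B - Z \<inter> ?B) y \<le> f0 y"
        using y d0[of y] by (auto simp: f0_def H_def split: split_indicator)
    qed
    then have "m * measure circle_measure ?B + measure circle_measure (?B - Z \<inter> ?B) \<le> measure (law f0) ?B"
      using Bc ZBc by (intro measure_law_ge f0_pdf circle_ball_borel circle_ball_subset) auto
    moreover have "measure circle_measure (?B - Z \<inter> ?B) = measure circle_measure ?B - measure circle_measure (Z \<inter> ?B)"
      using Bc ZBc by (intro finite_measure_Diff) auto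
    moreover have "measure circle_measure (Z \<inter> ?B) \<le> r" using Z(2)[OF x r(1)] .
    moreover have B2: "2 * r \<le> measure circle_measure ?B"
      using x K r by (intro measure_circle_ball_ge) auto
    moreover have "m * (2 * r) \<le> m * measure circle_measure ?B" using B2 m0 by (rule mult_left_mono)
    moreover have "2 * (m + 1/2) * r = m * (2 * r) + r" by (simp add: algebra_simps)
    ultimately show ?thesis by linarith
  qed
  show ?thesis
    by (rule that[of f0 "min u (1/2)"]) (use f0_pdf val set small mass u in \<open>simp_all add: m_def K_def\<close>)
qed

section \<open>Combining the covering of the minimal set with that of its complement\<close>

theorem theorem1p3:
  fixes f :: "real \<Rightarrow> real" and L :: "nat \<Rightarrow> real"
  assumes "circle_pdf f"
    and "antimono_on {1..} L"
    and "\<And>n. n \<ge> 1 \<Longrightarrow> 0 < L n \<and> L n < 1"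
    and "limsup (\<lambda>n. ereal ((\<Sum>k=1..n. L k) / ln (real n)))
           \<ge> (if min_val f = 0 then \<infinity> else ereal (1 / min_val f))"
    and "min_set f \<in> null_sets circle_measure"
  shows "\<forall>\<epsilon>>0. \<exists>f\<^sub>0. circle_pdf f\<^sub>0 \<and> min_val f\<^sub>0 = min_val f \<and> min_set f\<^sub>0 = min_set f
           \<and> measure circle_measure {x \<in> circle. f x \<noteq> f\<^sub>0 x} \<le> \<epsilon>
           \<and> dvoretzky_covered f\<^sub>0 L"
proof (intro allI impI)
  fix \<epsilon> :: real assume \<epsilon>: "0 < \<epsilon>"
  note anti = assms(2) and lim = assms(4)
  have pos: "0 < L n" if "1 \<le> n" for n using assms(3) that by blast
  \<comment> \<open>The complement of the minimal set is covered for every density with the minimum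
    of \<open>f\<close>, so only the minimal set itself remains.\<close>
  have covered: "dvoretzky_covered g L"
    if g: "circle_pdf g" and val: "min_val g = min_val f"
      and K: "AE \<omega> in (\<Pi>\<^sub>M n\<in>{1..}. law g). min_set g \<subseteq> limsup (\<lambda>n. circle_arc (\<omega> n) (L n))" for g
  proof -
    have "AE \<omega> in (\<Pi>\<^sub>M n\<in>{1..}. law g). circle - min_set g \<subseteq> limsup (\<lambda>n. circle_arc (\<omega> n) (L n))"
      by (rule AE_complement_min_set_subset_limsup_arcs[OF g anti pos]) (unfold val, simp_all only: lim)
    then show ?thesis
      using K unfolding dvoretzky_covered_def
    proof eventually_elim
      case (elim \<omega>)
      have "limsup (\<lambda>n. circle_arc (\<omega> n) (L n)) \<subseteq> circle"
        unfolding limsup_INF_SUP using circle_arc_subset by blast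
      with elim show ?case by blast
    qed
  qed
  show "\<exists>f\<^sub>0. circle_pdf f\<^sub>0 \<and> min_val f\<^sub>0 = min_val f \<and> min_set f\<^sub>0 = min_set f
           \<and> measure circle_measure {x \<in> circle. f x \<noteq> f\<^sub>0 x} \<le> \<epsilon> \<and> dvoretzky_covered f\<^sub>0 L"
  \<comment> \<open>With an empty minimal set \<open>f\<close> itself is covered and needs no
    change.\<close>
  proof (cases "min_set f = {}")
    case True
    then have "dvoretzky_covered f L" using covered[of f] assms(1) by simp
    then show ?thesis using assms(1) \<epsilon> by (intro exI[of _ f]) simp
  next
    case False
    obtain f\<^sub>0 u where f0: "circle_pdf f\<^sub>0" "min_val f\<^sub>0 = min_val f" "min_set f\<^sub>0 = min_set f"
      "measure circle_measure {x \<in> circle. f x \<noteq> f\<^sub>0 x} \<le> \<epsilon>" and u: "0 < u"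
      and mass: "\<And>x r. x \<in> min_set f \<Longrightarrow> 0 < r \<Longrightarrow> r \<le> u \<Longrightarrow>
        2 * (min_val f + 1/2) * r \<le> measure (law f\<^sub>0) (circle_ball x r)"
      using density_modification[OF assms(1,5) False \<epsilon>] by blast
    have m: "0 \<le> min_val f" using assms(1) by (intro min_val_nonneg) (simp add: circle_pdf_def)
    obtain q where q: "1 < (min_val f + 1/2) * q" "\<exists>\<^sub>F n in sequentially. q * ln (real n) \<le> (\<Sum>k=1..n. L k)"
      using frequently_ge_mult_ln[OF lim m, of "min_val f + 1/2"] by auto
    have "AE \<omega> in (\<Pi>\<^sub>M n\<in>{1..}. law f\<^sub>0). min_set f \<subseteq> limsup (\<lambda>n. circle_arc (\<omega> n) (L n))"
      using m u mass by (intro AE_subset_limsup_arcs[OF f0(1) anti pos _ q]) (auto simp: min_set_def)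
    then have "dvoretzky_covered f\<^sub>0 L" using covered[OF f0(1,2)] f0(3) by simp
    then show ?thesis using f0 by blast
  qed
qed

end
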